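(* For a prime $p$ let $$G_2:=\langle x,y\mid x^{p^2},\ y^{p^2},\ x^y=x^{p+1}\rangle,$$ $$G_7:=\langle w,x,y,z\mid w^p,\ x^p,\ y^p,\ z^p,\ [y,z]=x,\ [x,z]=w\rangle.$$ For any prime $p\ge 5$ the groups $G_2$ and $G_7$ are non-abelian Beauville groups of order $p^4$. For $p=3$, the groups $G_2$ and $G_7$ are not Beauville groups.
   Context: Let $G$ be a finite group with identity $e$. For $x,y\in G$ put $$\Sigma(x,y):=\bigcup_{i=1}^{|G|}\bigcup_{g\in G}\{(x^i)^g,(y^i)^g,((xy)^i)^g\},$$ where $a^g$ denotes the conjugate $g^{-1}ag$. A Beauville structure for $G$ is a pair of generating sets $\{x_1,y_1\},\{x_2,y_2\}$ of $G$ (i.e. $\langle x_1,y_1\rangle=\langle x_2,y_2\rangle=G$) such that $\Sigma(x_1,y_1)\cap\Sigma(x_2,y_2)=\{e\}$. $G$ is a Beauville group if there exists a Beauville structure for $G$. Presentation conventions: $[a,b]=aba^{-1}b^{-1}$, and relations $[a,b]=e$ between commuting generators are omitted, i.e. any two generators whose commutator or conjugate is not specified by a listed relation are understood to commute. Thus in $G_7$ the element $w$ is central and $x$ commutes with $y$. *)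

theory Defs
  imports "HOL-Algebra.Generated_Groups" "HOL-Computational_Algebra.Primes"
begin

section \<open>Conjugates, commutators and Beauville groups\<close>

definition conjugate :: "('a, 'b) monoid_scheme \<Rightarrow> 'a \<Rightarrow> 'a \<Rightarrow> 'a" where
  "conjugate G a g = inv\<^bsub>G\<^esub> g \<otimes>\<^bsub>G\<^esub> a \<otimes>\<^bsub>G\<^esub> g"

definition commutator :: "('a, 'b) monoid_scheme \<Rightarrow> 'a \<Rightarrow> 'a \<Rightarrow> 'a" where
  "commutator G a b = a \<otimes>\<^bsub>G\<^esub> b \<otimes>\<^bsub>G\<^esub> inv\<^bsub>G\<^esub> a \<otimes>\<^bsub>G\<^esub> inv\<^bsub>G\<^esub> b"

definition Sigma_set :: "('a, 'b) monoid_scheme \<Rightarrow> 'a \<Rightarrow> 'a \<Rightarrow> 'a set" where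
  "Sigma_set G x y = (\<Union>i\<in>{1..order G}. \<Union>g\<in>carrier G.
     {conjugate G (x [^]\<^bsub>G\<^esub> i) g, conjugate G (y [^]\<^bsub>G\<^esub> i) g,
      conjugate G ((x \<otimes>\<^bsub>G\<^esub> y) [^]\<^bsub>G\<^esub> i) g})"

definition beauville_structure ::
  "('a, 'b) monoid_scheme \<Rightarrow> 'a \<Rightarrow> 'a \<Rightarrow> 'a \<Rightarrow> 'a \<Rightarrow> bool" where
  "beauville_structure G x1 y1 x2 y2 \<longleftrightarrow>
     {x1, y1} \<subseteq> carrier G \<and> {x2, y2} \<subseteq> carrier G \<and>
     generate G {x1, y1} = carrier G \<and> generate G {x2, y2} = carrier G \<and>
     Sigma_set G x1 y1 \<inter> Sigma_set G x2 y2 = {\<one>\<^bsub>G\<^esub>}"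

definition beauville_group :: "('a, 'b) monoid_scheme \<Rightarrow> bool" where
  "beauville_group G \<longleftrightarrow>
     group G \<and> finite (carrier G) \<and> (\<exists>x1 y1 x2 y2. beauville_structure G x1 y1 x2 y2)"


section \<open>Free groups\<close>

text \<open>A letter \<open>(a, True)\<close> stands for the generator \<open>a\<close>, and \<open>(a, False)\<close> for its formal
  inverse. The free group on the whole type of generators consists of the words modulo
  the congruence generated by cancelling adjacent mutually inverse letters.\<close>

type_synonym 'a word = "('a \<times> bool) list"

inductive word_eq :: "'a word \<Rightarrow> 'a word \<Rightarrow> bool" where
  cancel: "word_eq (u @ [(a, b), (a, \<not> b)] @ v) (u @ v)"
| refl: "word_eq u u"
| sym: "word_eq u v \<Longrightarrow> word_eq v u"
| trans: "word_eq u v \<Longrightarrow> word_eq v w \<Longrightarrow> word_eq u w"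

definition word_rel :: "('a word \<times> 'a word) set" where
  "word_rel = {(u, v). word_eq u v}"

definition free_group :: "'a word set monoid" where
  "free_group =
     \<lparr>carrier = UNIV // word_rel,
      monoid.mult = (\<lambda>A B. \<Union>u\<in>A. \<Union>v\<in>B. word_rel `` {u @ v}),
      monoid.one = word_rel `` {[]}\<rparr>"

definition free_gen :: "'a \<Rightarrow> 'a word set" where
  "free_gen a = word_rel `` {[(a, True)]}"

lemma equiv_word_rel: "equiv UNIV word_rel"
  by (rule equivI)
     (auto simp: word_rel_def refl_on_def sym_def trans_def
           intro: word_eq.refl word_eq.sym word_eq.trans)

lemma word_eq_append_left: "word_eq u v \<Longrightarrow> word_eq (w @ u) (w @ v)"
proof (induction rule: word_eq.induct)
  case (cancel u a b v)
  show ?case using word_eq.cancel[of "w @ u" a b v] by simp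
qed (auto intro: word_eq.intros)

lemma word_eq_append_right: "word_eq u v \<Longrightarrow> word_eq (u @ w) (v @ w)"
proof (induction rule: word_eq.induct)
  case (cancel u a b v)
  show ?case using word_eq.cancel[of u a b "v @ w"] by simp
qed (auto intro: word_eq.intros)

lemma word_rel_congruent2:
  "(\<lambda>u v. word_rel `` {u @ v}) respects2 word_rel"
proof (rule congruent2I[OF equiv_word_rel equiv_word_rel])
  show "word_rel `` {y @ w} = word_rel `` {z @ w}" if "(y, z) \<in> word_rel" for y z w :: "'a word"
    using that by (intro equiv_class_eq[OF equiv_word_rel])
                  (simp add: word_rel_def word_eq_append_right)
  show "word_rel `` {w @ y} = word_rel `` {w @ z}" if "(y, z) \<in> word_rel" for y z w :: "'a word"
    using that by (intro equiv_class_eq[OF equiv_word_rel])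
                  (simp add: word_rel_def word_eq_append_left)
qed

lemma mult_free_group:
  "word_rel `` {u} \<otimes>\<^bsub>free_group\<^esub> word_rel `` {v} = word_rel `` {u @ v}"
  unfolding free_group_def
  using UN_equiv_class2[OF equiv_word_rel equiv_word_rel word_rel_congruent2, of u v] by simp

lemma word_eq_inverse: "word_eq (rev (map (\<lambda>(a, b). (a, \<not> b)) u) @ u) []"
proof (induction u)
  case Nil
  show ?case by (simp add: word_eq.refl)
next
  case (Cons l u)
  obtain a b where l: "l = (a, b)" by (cases l)
  have "word_eq (rev (map (\<lambda>(a, b). (a, \<not> b)) u) @ [(a, \<not> b), (a, \<not> \<not> b)] @ u)
                (rev (map (\<lambda>(a, b). (a, \<not> b)) u) @ u)"
    by (rule word_eq.cancel)
  with Cons.IH show ?case by (simp add: l word_eq.trans)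
qed

lemma carrier_free_group: "carrier free_group = range (\<lambda>u. word_rel `` {u})"
  by (auto simp: free_group_def quotient_def)

lemma one_free_group: "\<one>\<^bsub>free_group\<^esub> = word_rel `` {[]}"
  by (simp add: free_group_def)

lemma group_free_group: "group free_group"
proof (rule groupI)
  fix A assume "A \<in> carrier (free_group :: 'a word set monoid)"
  then obtain u where A: "A = word_rel `` {u}" by (auto simp: carrier_free_group)
  have "word_rel `` {rev (map (\<lambda>(a, b). (a, \<not> b)) u) @ u} = word_rel `` {[]}"
    using word_eq_inverse[of u]
    by (intro equiv_class_eq[OF equiv_word_rel]) (simp add: word_rel_def)
  then have "word_rel `` {rev (map (\<lambda>(a, b). (a, \<not> b)) u)} \<otimes>\<^bsub>free_group\<^esub> A = \<one>\<^bsub>free_group\<^esub>"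
    by (simp add: A mult_free_group one_free_group)
  then show "\<exists>B\<in>carrier free_group. B \<otimes>\<^bsub>free_group\<^esub> A = \<one>\<^bsub>free_group\<^esub>"
    by (auto simp: carrier_free_group)
qed (auto simp: carrier_free_group mult_free_group one_free_group)

lemma free_gen_closed [simp]: "free_gen a \<in> carrier free_group"
  by (auto simp: free_gen_def carrier_free_group)


section \<open>Group presentations\<close>

definition normal_closure :: "('a, 'b) monoid_scheme \<Rightarrow> 'a set \<Rightarrow> 'a set" where
  "normal_closure G R = generate G (\<Union>r\<in>R. \<Union>g\<in>carrier G. {conjugate G r g})"

text \<open>The generators are all elements of the type \<open>'a\<close>; the relators are elements of the
  free group on them.\<close>

definition presented_group :: "'a word set set \<Rightarrow> 'a word set set monoid" where
  "presented_group R = free_group Mod normal_closure free_group R"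

lemma (in group) normal_closure_normal:
  assumes "R \<subseteq> carrier G"
  shows "normal_closure G R \<lhd> G"
  unfolding normal_closure_def
proof (rule normal_generateI)
  show "(\<Union>r\<in>R. \<Union>g\<in>carrier G. {conjugate G r g}) \<subseteq> carrier G"
    using assms by (auto simp: conjugate_def)
next
  fix h g
  assume "h \<in> (\<Union>r\<in>R. \<Union>g\<in>carrier G. {conjugate G r g})" and g: "g \<in> carrier G"
  then obtain r k where rk: "r \<in> R" "k \<in> carrier G" "h = conjugate G r k" by auto
  with assms g have "g \<otimes> h \<otimes> inv g = conjugate G r (k \<otimes> inv g)"
    by (auto simp: conjugate_def inv_mult_group m_assoc subset_iff)
  with rk g show "g \<otimes> h \<otimes> inv g \<in> (\<Union>r\<in>R. \<Union>g\<in>carrier G. {conjugate G r g})"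
    by auto
qed

lemma group_presented_group:
  assumes "R \<subseteq> carrier free_group"
  shows "group (presented_group R)"
  unfolding presented_group_def
  by (rule normal.factorgroup_is_group[OF group.normal_closure_normal[OF group_free_group assms]])


section \<open>The two groups\<close>

text \<open>A relation \<open>l = r\<close> is encoded as the relator \<open>l r\<^sup>-\<^sup>1\<close>.\<close>

datatype gen2 = X2 | Y2

definition relators2 :: "nat \<Rightarrow> gen2 word set set" where
  "relators2 p =
    (let F = free_group; x = free_gen X2; y = free_gen Y2 in
      {x [^]\<^bsub>F\<^esub> (p ^ 2), y [^]\<^bsub>F\<^esub> (p ^ 2),
       conjugate F x y \<otimes>\<^bsub>F\<^esub> inv\<^bsub>F\<^esub> (x [^]\<^bsub>F\<^esub> (p + 1))})"

definition G2 :: "nat \<Rightarrow> gen2 word set set monoid" where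
  "G2 p = presented_group (relators2 p)"

datatype gen7 = W7 | X7 | Y7 | Z7

text \<open>The last four relators are the commutation relations customarily omitted from the
  presentation: \<open>w\<close> is central, and \<open>x\<close> commutes with \<open>y\<close>.\<close>

definition relators7 :: "nat \<Rightarrow> gen7 word set set" where
  "relators7 p =
    (let F = free_group; w = free_gen W7; x = free_gen X7; y = free_gen Y7; z = free_gen Z7 in
      {w [^]\<^bsub>F\<^esub> p, x [^]\<^bsub>F\<^esub> p, y [^]\<^bsub>F\<^esub> p, z [^]\<^bsub>F\<^esub> p,
       commutator F y z \<otimes>\<^bsub>F\<^esub> inv\<^bsub>F\<^esub> x, commutator F x z \<otimes>\<^bsub>F\<^esub> inv\<^bsub>F\<^esub> w,
       commutator F w x, commutator F w y, commutator F w z, commutator F x y})"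

definition G7 :: "nat \<Rightarrow> gen7 word set set monoid" where
  "G7 p = presented_group (relators7 p)"

lemma group_G2: "group (G2 p)"
proof -
  interpret F: group "free_group :: gen2 word set monoid" by (rule group_free_group)
  show ?thesis
    unfolding G2_def by (rule group_presented_group) (simp add: relators2_def Let_def conjugate_def)
qed

lemma group_G7: "group (G7 p)"
proof -
  interpret F: group "free_group :: gen7 word set monoid" by (rule group_free_group)
  show ?thesis
    unfolding G7_def by (rule group_presented_group) (simp add: relators7_def Let_def commutator_def)
qed

end

theory Submission
  imports Defs "HOL-Algebra.Multiplicative_Group" "HOL-Number_Theory.Cong"
begin

text \<open>Both groups have Frattini quotient \<open>(\<int>/p)\<^sup>2\<close>. A generating triple \<open>x, y, xy\<close> occupies three
  distinct lines of this plane, and for \<open>p \<ge> 5\<close> there are at least six lines, so two triples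
  can avoid each other. Elements over different lines have no conjugate non-trivial powers: \<open>G\<^sub>7\<close> has
  exponent \<open>p\<close>, while in \<open>G\<^sub>2\<close> the \<open>p\<close>-th power map induces an isomorphism from the plane onto the
  centre. For \<open>p = 3\<close> there are only four lines, so two triples share at least two of them, hence one
  other than a prescribed line. In \<open>G\<^sub>2\<close> two elements over a common line have equal cubes up to
  inversion; in \<open>G\<^sub>7\<close>, if the common line is not the one of the abelian subgroup \<open>\<langle>w, x, y\<rangle>\<close>, the
  elements themselves are conjugate up to inversion.\<close>

section \<open>Homomorphisms out of presented groups\<close>

text \<open>Rewriting words bounds a presented group only from above: moving letters past each other
  gives normal forms, hence at most p^4 elements, but does not show that they differ. The lower
  bound comes from explicit groups on tuples of exponents, onto which the presentation maps because
  the relators hold there; a surjection from at most p^4 elements onto exactly p^4 is bijective. All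
  questions about Beauville structures then become integer congruences. The plane sees exponents
  only modulo p: if g^i and h^j over different lines are conjugate, then p divides i and j. This
  settles the second group for p at least 5, where the exponent is p, but the first has exponent p^2
  and needs another comparison modulo p^2. The exponent of the second group depends on a sum of
  squares with denominator 6, which is what breaks at p = 3. For p = 3 the prescribed line is
  \<open>\<beta> = 0\<close>. Each triple misses at most one of the three remaining lines, so two
  triples always leave a common one among them.\<close>

primrec word_value :: "('b, 'c) monoid_scheme \<Rightarrow> ('a \<Rightarrow> 'b) \<Rightarrow> 'a word \<Rightarrow> 'b" where
  "word_value G f [] = \<one>\<^bsub>G\<^esub>"
| "word_value G f (l # u) = (if snd l then f (fst l) else inv\<^bsub>G\<^esub> f (fst l)) \<otimes>\<^bsub>G\<^esub> word_value G f u"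

lemma (in group) word_value_closed:
  assumes "range f \<subseteq> carrier G"
  shows "word_value G f u \<in> carrier G"
  using assms by (induction u) auto

lemma (in group) word_value_append:
  assumes "range f \<subseteq> carrier G"
  shows "word_value G f (u @ v) = word_value G f u \<otimes> word_value G f v"
proof (induction u)
  case (Cons l u)
  have "f (fst l) \<in> carrier G" using assms by auto
  with Cons show ?case by (simp add: word_value_closed[OF assms] m_assoc)
qed (simp add: word_value_closed[OF assms])

lemma (in group) word_value_word_eq:
  assumes "range f \<subseteq> carrier G" and "word_eq u v"
  shows "word_value G f u = word_value G f v"
  using assms(2)
proof (induction rule: word_eq.induct)
  case (cancel u a b v)
  have "f a \<in> carrier G" using assms by auto
  then have "word_value G f [(a, b), (a, \<not> b)] = \<one>" by simp
  then show ?case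
    by (simp only: word_value_append[OF assms(1)]) (simp add: word_value_closed[OF assms(1)])
qed auto

lemma (in group) free_group_universal:
  assumes f: "range f \<subseteq> carrier G"
  obtains h where "h \<in> hom free_group G" "\<And>a. h (free_gen a) = f a"
proof -
  \<comment> \<open>Evaluation is constant on a class of words, so the image of a class is a
    singleton and no representative has to be chosen.\<close>
  define h where "h A = the_elem (word_value G f ` A)" for A
  have h: "h (word_rel `` {u}) = word_value G f u" for u
  proof -
    have "word_value G f ` (word_rel `` {u}) = {word_value G f u}"
      using word_value_word_eq[OF f] by (fastforce simp: word_rel_def intro: word_eq.refl)
    then show ?thesis by (simp add: h_def)
  qed
  show thesis
  proof
    show "h \<in> hom free_group G"
      by (rule homI)
         (auto simp: carrier_free_group h mult_free_group word_value_append[OF f] word_value_closed[OF f])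
    show "h (free_gen a) = f a" for a
    proof -
      have "f a \<in> carrier G" using f by auto
      then show ?thesis by (simp add: free_gen_def h)
    qed
  qed
qed

section \<open>Quotients by a normal closure: mapping out, induction over generators, recognition by
  counting\<close>

definition presented_gen :: "'a word set set \<Rightarrow> 'a \<Rightarrow> 'a word set set" where
  "presented_gen R a = normal_closure free_group R #>\<^bsub>free_group\<^esub> free_gen a"

lemma presented_group_proj:
  fixes R :: "'a word set set"
  assumes R: "R \<subseteq> carrier free_group"
  obtains \<pi> where "group_hom free_group (presented_group R) \<pi>"
    "\<pi> ` carrier free_group = carrier (presented_group R)"
    "\<And>a. \<pi> (free_gen a) = presented_gen R a" "\<And>r. r \<in> R \<Longrightarrow> \<pi> r = \<one>\<^bsub>presented_group R\<^esub>"
proof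
  let ?N = "normal_closure free_group R"
  interpret F: group "free_group :: 'a word set monoid" by (rule group_free_group)
  interpret normal ?N "free_group :: 'a word set monoid" by (rule F.normal_closure_normal[OF R])
  show "group_hom free_group (presented_group R) ((#>\<^bsub>free_group\<^esub>) ?N)"
    using r_coset_hom_Mod group_presented_group[OF R]
    by (intro group_hom.intro group_hom_axioms.intro F.is_group) (auto simp: presented_group_def)
  show "(#>\<^bsub>free_group\<^esub>) ?N ` carrier free_group = carrier (presented_group R)"
    by (auto simp: presented_group_def carrier_FactGroup)
  show "?N #>\<^bsub>free_group\<^esub> free_gen a = presented_gen R a" for a
    by (simp add: presented_gen_def)
  show "?N #>\<^bsub>free_group\<^esub> r = \<one>\<^bsub>presented_group R\<^esub>" if "r \<in> R" for r
  proof -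
    have "conjugate free_group r \<one>\<^bsub>free_group\<^esub> = r" using R that by (auto simp: conjugate_def)
    then have "r \<in> (\<Union>r\<in>R. \<Union>g\<in>carrier free_group. {conjugate free_group r g})"
      using that by force
    then have "r \<in> ?N" unfolding normal_closure_def by (rule generate.incl)
    then show ?thesis by (simp add: presented_group_def rcos_const)
  qed
qed

lemma presented_gen_closed:
  assumes "R \<subseteq> carrier free_group"
  shows "presented_gen R a \<in> carrier (presented_group R)"
proof -
  obtain \<pi> where "\<pi> ` carrier free_group = carrier (presented_group R)"
    "\<And>a. \<pi> (free_gen a) = presented_gen R a"
    using presented_group_proj[OF assms] by metis
  then show ?thesis using free_gen_closed by fastforce
qed

text \<open>Von Dyck's theorem: the kernel of the extension to the free group is normal, so once it
  contains the relators it contains their normal closure. The hypothesis on relators speaks of any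
  homomorphism extending \<open>f\<close>, so that an instance can be checked by homomorphism rules
  without evaluating words.\<close>

lemma presented_group_universal:
  assumes R: "R \<subseteq> carrier free_group" and "group G" and f: "range f \<subseteq> carrier G"
    and rel: "\<And>h r. group_hom free_group G h \<Longrightarrow> (\<And>a. h (free_gen a) = f a) \<Longrightarrow> r \<in> R \<Longrightarrow> h r = \<one>\<^bsub>G\<^esub>"
  obtains g where "g \<in> hom (presented_group R) G" "\<And>a. g (presented_gen R a) = f a"
proof -
  interpret G: group G by fact
  interpret F: group "free_group :: 'a word set monoid" by (rule group_free_group)
  obtain h where h: "h \<in> hom free_group G" "\<And>a. h (free_gen a) = f a"
    using G.free_group_universal[OF f] by blast
  interpret h: group_hom free_group G h
    using h by unfold_locales auto
  have "(\<Union>r\<in>R. \<Union>g\<in>carrier free_group. {conjugate free_group r g}) \<subseteq> kernel free_group G h"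
    using rel[OF h.group_hom_axioms h(2)] R by (auto simp: kernel_def conjugate_def subset_iff)
  then have "normal_closure free_group R \<subseteq> kernel free_group G h"
    unfolding normal_closure_def by (rule F.generate_subgroup_incl[OF _ h.subgroup_kernel])
  from h.FactGroup_universal_kernel[OF F.normal_closure_normal[OF R] this]
  obtain g where g: "g \<in> hom (free_group Mod normal_closure free_group R) G"
    "\<And>x. x \<in> carrier free_group \<Longrightarrow> g (normal_closure free_group R #>\<^bsub>free_group\<^esub> x) = h x"
    by blast
  show thesis
  proof
    show "g \<in> hom (presented_group R) G" using g(1) by (simp add: presented_group_def)
    show "g (presented_gen R a) = f a" for a by (simp add: presented_gen_def g(2) h(2))
  qed
qed

text \<open>Meant for showing that normal forms exhaust the group. Since each generator has finite
  order, its inverse is a natural power, and closure under right multiplication by the generators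
  alone suffices.\<close>

lemma presented_group_induct:
  assumes R: "R \<subseteq> carrier free_group"
    and one: "\<one>\<^bsub>presented_group R\<^esub> \<in> S"
    and fin: "\<And>a. \<exists>n>0. presented_gen R a [^]\<^bsub>presented_group R\<^esub> (n::nat) = \<one>\<^bsub>presented_group R\<^esub>"
    and step: "\<And>s a. s \<in> S \<Longrightarrow> s \<in> carrier (presented_group R) \<Longrightarrow> s \<otimes>\<^bsub>presented_group R\<^esub> presented_gen R a \<in> S"
  shows "carrier (presented_group R) \<subseteq> S"
proof -
  let ?P = "presented_group R"
  obtain \<pi> where hom: "group_hom free_group ?P \<pi>" and onto: "\<pi> ` carrier free_group = carrier ?P"
    and gen: "\<And>a. \<pi> (free_gen a) = presented_gen R a"
    using presented_group_proj[OF R] by metis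
  interpret \<pi>: group_hom free_group ?P \<pi> by (rule hom)
  have pow: "s \<otimes>\<^bsub>?P\<^esub> presented_gen R a [^]\<^bsub>?P\<^esub> (n::nat) \<in> S" if "s \<in> S" "s \<in> carrier ?P" for s a n
  proof (induction n)
    case (Suc n)
    then show ?case
      using step[OF Suc] that presented_gen_closed[OF R]
      by (simp add: \<pi>.H.m_assoc[symmetric])
  qed (use that in simp)
  have "\<pi> (word_rel `` {u}) \<in> S \<inter> carrier ?P" for u
  proof (induction u rule: rev_induct)
    case Nil
    show ?case using one \<pi>.hom_one by (simp add: one_free_group)
  next
    case (snoc l u)
    obtain a b where l: "l = (a, b)" by fastforce
    have u: "word_rel `` {u} \<in> carrier free_group" by (simp add: carrier_free_group)
    show ?case
    proof (cases b)
      case True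
      then have "word_rel `` {u @ [l]} = word_rel `` {u} \<otimes>\<^bsub>free_group\<^esub> free_gen a"
        by (simp add: free_gen_def mult_free_group l)
      then have "\<pi> (word_rel `` {u @ [l]}) = \<pi> (word_rel `` {u}) \<otimes>\<^bsub>?P\<^esub> presented_gen R a"
        using u by (simp add: gen)
      then show ?thesis using step snoc by (simp add: presented_gen_closed[OF R])
    next
      case False
      obtain n where n: "n > 0" "presented_gen R a [^]\<^bsub>?P\<^esub> (n::nat) = \<one>\<^bsub>?P\<^esub>" using fin by blast
      have c: "presented_gen R a \<in> carrier ?P" by (rule presented_gen_closed[OF R])
      have "presented_gen R a [^]\<^bsub>?P\<^esub> (n - 1) \<otimes>\<^bsub>?P\<^esub> presented_gen R a = \<one>\<^bsub>?P\<^esub>"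
        using n c by (metis Suc_diff_1 \<pi>.H.nat_pow_Suc)
      then have inv: "inv\<^bsub>?P\<^esub> presented_gen R a = presented_gen R a [^]\<^bsub>?P\<^esub> (n - 1)"
        using c by (intro \<pi>.H.inv_equality) auto
      \<comment> \<open>One cancellation identifies the class of the inverse letter with the inverse
        of the free generator.\<close>
      have "word_eq ([] @ [(a, False), (a, \<not> False)] @ []) ([] @ [])" by (rule word_eq.cancel)
      then have "word_rel `` {[(a, False)]} \<otimes>\<^bsub>free_group\<^esub> free_gen a = \<one>\<^bsub>free_group\<^esub>"
        unfolding free_gen_def mult_free_group one_free_group
        by (intro equiv_class_eq[OF equiv_word_rel]) (simp add: word_rel_def)
      then have "inv\<^bsub>free_group\<^esub> free_gen a = word_rel `` {[(a, False)]}"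
        by (intro \<pi>.G.inv_equality) (auto simp: carrier_free_group free_gen_def)
      then have "word_rel `` {u @ [l]} = word_rel `` {u} \<otimes>\<^bsub>free_group\<^esub> inv\<^bsub>free_group\<^esub> free_gen a"
        using False by (simp add: mult_free_group l)
      then have "\<pi> (word_rel `` {u @ [l]}) = \<pi> (word_rel `` {u}) \<otimes>\<^bsub>?P\<^esub> presented_gen R a [^]\<^bsub>?P\<^esub> (n - 1)"
        using u by (simp add: gen inv)
      then show ?thesis using pow snoc by (simp add: c)
    qed
  qed
  then show ?thesis unfolding onto[symmetric] carrier_free_group by blast
qed

text \<open>The induced homomorphism is onto because its image is a subgroup containing the
  generating set \<open>range f\<close>. A finite domain no larger than its image then forces
  injectivity, so an upper bound on the order replaces any study of the kernel.\<close>

lemma presented_group_iso: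
  fixes M :: "('b, 'c) monoid_scheme"
  assumes R: "R \<subseteq> carrier free_group" and "group M" and f: "range f \<subseteq> carrier M"
    and rel: "\<And>h r. group_hom free_group M h \<Longrightarrow> (\<And>a. h (free_gen a) = f a) \<Longrightarrow> r \<in> R \<Longrightarrow> h r = \<one>\<^bsub>M\<^esub>"
    and gen: "generate M (range f) = carrier M"
    and fin: "finite (carrier (presented_group R))" and le: "order (presented_group R) \<le> order M"
  shows "presented_group R \<cong> M"
proof -
  interpret M: group M by fact
  obtain g where g: "g \<in> hom (presented_group R) M" "\<And>a. g (presented_gen R a) = f a"
    by (rule presented_group_universal[OF R \<open>group M\<close> f]) (use rel in blast)+
  interpret P: group "presented_group R" by (rule group_presented_group[OF R])
  interpret g: group_hom "presented_group R" M g
    using g by unfold_locales auto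
  have "range f \<subseteq> g ` carrier (presented_group R)"
    using presented_gen_closed[OF R] g(2) by (metis image_eqI image_subsetI)
  then have "carrier M \<subseteq> g ` carrier (presented_group R)"
    unfolding gen[symmetric] by (rule M.generate_subgroup_incl[OF _ g.img_is_subgroup])
  then have onto: "g ` carrier (presented_group R) = carrier M" by auto
  then have "card (g ` carrier (presented_group R)) = card (carrier (presented_group R))"
    using le card_image_le[OF fin, of g] by (simp add: order_def)
  then have "inj_on g (carrier (presented_group R))" by (rule eq_card_imp_inj_on[OF fin])
  then show ?thesis using g(1) onto by (auto simp: is_iso_def iso_def bij_betw_def)
qed


section \<open>Beauville structures and lines in the plane over the prime field\<close>

lemma mem_Sigma_set:
  "s \<in> Sigma_set G x y \<longleftrightarrow> (\<exists>g\<in>{x, y, x \<otimes>\<^bsub>G\<^esub> y}. \<exists>i\<in>{1..order G}. \<exists>k\<in>carrier G.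
     s = conjugate G (g [^]\<^bsub>G\<^esub> i) k)"
  unfolding Sigma_set_def by blast

lemma (in group) conjugate_one [simp]: "k \<in> carrier G \<Longrightarrow> conjugate G \<one> k = \<one>"
  by (simp add: conjugate_def)

lemma (in group_hom) hom_conjugate:
  "x \<in> carrier G \<Longrightarrow> g \<in> carrier G \<Longrightarrow> h (conjugate G x g) = conjugate H (h x) (h g)"
  by (simp add: conjugate_def)

text \<open>\<open>Sigma_set\<close> takes exponents up to the group order, which an isomorphism
  preserves; hence it carries Sigma sets to Sigma sets, and by injectivity their intersection to the
  intersection of the images.\<close>

lemma beauville_group_iso:
  assumes "G \<cong> H" and G: "beauville_group G" and "group H"
  shows "beauville_group H"
proof -
  interpret G: group G using G by (simp add: beauville_group_def)
  interpret H: group H by fact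
  obtain \<phi> where \<phi>: "\<phi> \<in> iso G H" using assms(1) by (auto simp: is_iso_def)
  interpret \<phi>: group_hom G H \<phi>
    using \<phi> by unfold_locales (auto simp: iso_def)
  have onto: "\<phi> ` carrier G = carrier H" using \<phi> by (auto simp: iso_def bij_betw_def)
  have inj: "inj_on \<phi> (carrier G)" using \<phi> by (auto simp: iso_def bij_betw_def)
  have ord: "order H = order G" using iso_same_card[OF assms(1)] by (simp add: order_def)
  have Sigma: "Sigma_set H (\<phi> x) (\<phi> y) = \<phi> ` Sigma_set G x y" if "x \<in> carrier G" "y \<in> carrier G" for x y
  proof -
    have "conjugate H (\<phi> g [^]\<^bsub>H\<^esub> i) (\<phi> k) = \<phi> (conjugate G (g [^]\<^bsub>G\<^esub> i) k)"
      if "g \<in> carrier G" "k \<in> carrier G" for g k and i :: nat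
      using that by (simp add: \<phi>.hom_conjugate \<phi>.hom_nat_pow)
    with that show ?thesis
      unfolding Sigma_set_def ord onto[symmetric] image_UN
      by (simp add: \<phi>.hom_mult[symmetric] del: \<phi>.hom_mult)
  qed
  have Sigma_sub: "Sigma_set G x y \<subseteq> carrier G" if "x \<in> carrier G" "y \<in> carrier G" for x y
    using that by (auto simp: Sigma_set_def conjugate_def)
  obtain x1 y1 x2 y2 where b: "beauville_structure G x1 y1 x2 y2"
    using G by (auto simp: beauville_group_def)
  then have c: "x1 \<in> carrier G" "y1 \<in> carrier G" "x2 \<in> carrier G" "y2 \<in> carrier G"
    by (auto simp: beauville_structure_def)
  have gen: "generate H {\<phi> x, \<phi> y} = carrier H"
    if "x \<in> carrier G" "y \<in> carrier G" "generate G {x, y} = carrier G" for x y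
    using \<phi>.generate_img[of "{x, y}"] that onto by simp
  have "Sigma_set H (\<phi> x1) (\<phi> y1) \<inter> Sigma_set H (\<phi> x2) (\<phi> y2) =
      \<phi> ` (Sigma_set G x1 y1 \<inter> Sigma_set G x2 y2)"
    using c Sigma Sigma_sub inj by (simp add: inj_on_image_Int)
  then have "beauville_structure H (\<phi> x1) (\<phi> y1) (\<phi> x2) (\<phi> y2)"
    using b c gen by (auto simp: beauville_structure_def)
  moreover have "finite (carrier H)"
    using G onto by (metis beauville_group_def finite_imageI)
  ultimately show ?thesis using \<open>group H\<close> unfolding beauville_group_def by blast
qed

text \<open>A homomorphism to the plane, given by integer lifts \<open>\<alpha>\<close> and
  \<open>\<beta>\<close> of its two coordinates, with generators \<open>a\<close> and
  \<open>b\<close> over the standard basis. Integer values with congruences avoid arithmetic in a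
  quotient ring.\<close>

locale plane_coordinates = group G for G (structure) +
  fixes p :: int and \<alpha> \<beta> :: "'a \<Rightarrow> int" and a b
  assumes \<alpha>_mult: "g \<in> carrier G \<Longrightarrow> h \<in> carrier G \<Longrightarrow> [\<alpha> (g \<otimes> h) = \<alpha> g + \<alpha> h] (mod p)"
    and \<beta>_mult: "g \<in> carrier G \<Longrightarrow> h \<in> carrier G \<Longrightarrow> [\<beta> (g \<otimes> h) = \<beta> g + \<beta> h] (mod p)"
    and a_closed [simp]: "a \<in> carrier G" and b_closed [simp]: "b \<in> carrier G"
    and \<alpha>_a: "[\<alpha> a = 1] (mod p)" and \<beta>_a: "[\<beta> a = 0] (mod p)"
    and \<alpha>_b: "[\<alpha> b = 0] (mod p)" and \<beta>_b: "[\<beta> b = 1] (mod p)"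
    and generate_ab: "generate G {a, b} = carrier G"
    and finite: "finite (carrier G)"
begin

definition coords :: "'a \<Rightarrow> int \<Rightarrow> int \<Rightarrow> bool" where
  "coords g s t \<longleftrightarrow> g \<in> carrier G \<and> [\<alpha> g = s] (mod p) \<and> [\<beta> g = t] (mod p)"

lemma coords_mult: "coords g s t \<Longrightarrow> coords h s' t' \<Longrightarrow> coords (g \<otimes> h) (s + s') (t + t')"
  unfolding coords_def using \<alpha>_mult \<beta>_mult by (meson cong_add cong_trans m_closed)

lemma coords_one: "coords \<one> 0 0"
proof -
  have "[\<alpha> \<one> + 0 = \<alpha> \<one> + \<alpha> \<one>] (mod p)" "[\<beta> \<one> + 0 = \<beta> \<one> + \<beta> \<one>] (mod p)"
    using \<alpha>_mult[of \<one> \<one>] \<beta>_mult[of \<one> \<one>] by simp_all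
  then show ?thesis unfolding coords_def cong_add_lcancel by (simp add: cong_sym)
qed

lemma coords_pow: "coords g s t \<Longrightarrow> coords (g [^] (n::nat)) (int n * s) (int n * t)"
proof (induction n)
  case (Suc n)
  then show ?case using coords_mult[of "g [^] n" "int n * s" "int n * t" g s t]
    by (simp add: algebra_simps)
qed (simp add: coords_one)

lemma coords_inv: 
  assumes "coords g s t" shows "coords (inv g) (- s) (- t)"
proof -
  have g: "g \<in> carrier G" using assms by (simp add: coords_def)
  have "coords (inv g \<otimes> g) (\<alpha> (inv g) + s) (\<beta> (inv g) + t)"
    using coords_mult[OF _ assms, of "inv g" "\<alpha> (inv g)" "\<beta> (inv g)"] g by (simp add: coords_def)
  then have "coords \<one> (\<alpha> (inv g) + s) (\<beta> (inv g) + t)" using g by simp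
  with coords_one have "[\<alpha> (inv g) + s = 0] (mod p)" "[\<beta> (inv g) + t = 0] (mod p)"
    unfolding coords_def by (meson cong_sym cong_trans)+
  then show ?thesis using g by (simp add: coords_def cong_iff_dvd_diff)
qed

lemma coords_self: "g \<in> carrier G \<Longrightarrow> coords g (\<alpha> g) (\<beta> g)"
  by (simp add: coords_def)

lemma coords_conjugate:
  assumes "coords g s t" "k \<in> carrier G"
  shows "coords (conjugate G g k) s t"
  using coords_mult[OF coords_mult[OF coords_inv[OF coords_self] assms(1)] coords_self, of k k] assms(2)
  by (simp add: conjugate_def)

lemma coords_unique:
  "coords g s t \<Longrightarrow> coords g s' t' \<Longrightarrow> [s = s'] (mod p) \<and> [t = t'] (mod p)"
  unfolding coords_def by (meson cong_sym cong_trans)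

lemma coords_a: "coords a 1 0" and coords_b: "coords b 0 1"
  using \<alpha>_a \<beta>_a \<alpha>_b \<beta>_b by (auto simp: coords_def)

text \<open>For prime p, being prime to p means that both images in the plane are non-zero and span
  different lines.\<close>

definition det :: "'a \<Rightarrow> 'a \<Rightarrow> int" where
  "det g h = \<alpha> g * \<beta> h - \<alpha> h * \<beta> g"

lemma det_cong: "coords g s t \<Longrightarrow> coords h s' t' \<Longrightarrow> [det g h = s * t' - s' * t] (mod p)"
  unfolding coords_def det_def by (intro cong_diff cong_mult) auto

text \<open>Conjugation is invisible in the abelian plane, so equal conjugates give a linear
  relation between the images of \<open>g\<close> and \<open>h\<close>, which are independent modulo
  p.\<close>

lemma dvd_exponents_if_conjugate_pow_eq:
  assumes p: "prime p" and c: "g \<in> carrier G" "h \<in> carrier G" "k \<in> carrier G" "l \<in> carrier G"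
    and det: "\<not> p dvd det g h"
    and eq: "conjugate G (g [^] (i::nat)) k = conjugate G (h [^] (j::nat)) l"
  shows "p dvd int i" "p dvd int j"
proof -
  have "[int i * \<alpha> g = int j * \<alpha> h] (mod p) \<and> [int i * \<beta> g = int j * \<beta> h] (mod p)"
  proof (rule coords_unique)
    show "coords (conjugate G (g [^] i) k) (int i * \<alpha> g) (int i * \<beta> g)"
      by (intro coords_conjugate coords_pow coords_self c)
    show "coords (conjugate G (g [^] i) k) (int j * \<alpha> h) (int j * \<beta> h)"
      unfolding eq by (intro coords_conjugate coords_pow coords_self c)
  qed
  then have d: "p dvd int i * \<alpha> g - int j * \<alpha> h" "p dvd int i * \<beta> g - int j * \<beta> h"
    by (auto simp: cong_iff_dvd_diff)
  \<comment> \<open>Cramer's rule: this combination eliminates j and leaves i times the determinant;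
    the next one eliminates i.\<close>
  have "p dvd (int i * \<alpha> g - int j * \<alpha> h) * \<beta> h - (int i * \<beta> g - int j * \<beta> h) * \<alpha> h"
    by (intro dvd_diff dvd_mult2 d)
  also have "\<dots> = int i * det g h" by (simp add: det_def algebra_simps)
  finally show "p dvd int i" using det p by (simp add: prime_dvd_mult_iff)
  have "p dvd (int i * \<alpha> g - int j * \<alpha> h) * \<beta> g - (int i * \<beta> g - int j * \<beta> h) * \<alpha> g"
    by (intro dvd_diff dvd_mult2 d)
  also have "\<dots> = int j * det g h" by (simp add: det_def algebra_simps)
  finally show "p dvd int j" using det p by (simp add: prime_dvd_mult_iff)
qed

lemma generate_eqI:
  assumes "x \<in> carrier G" "y \<in> carrier G" "a \<in> generate G {x, y}" "b \<in> generate G {x, y}"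
  shows "generate G {x, y} = carrier G"
proof
  have sub: "subgroup (generate G {x, y}) G" using assms by (intro generate_is_subgroup) auto
  show "generate G {x, y} \<subseteq> carrier G" using sub by (rule subgroup.subset)
  show "carrier G \<subseteq> generate G {x, y}"
    unfolding generate_ab[symmetric] using sub assms by (intro generate_subgroup_incl) auto
qed

text \<open>A linear form vanishing modulo p on both generators vanishes on the whole group, in
  particular on \<open>a\<close> and \<open>b\<close>, so its coefficients are zero modulo p. If the
  determinant vanished, the coordinates of \<open>x\<close> and of \<open>y\<close> would supply
  such forms.\<close>

lemma not_dvd_det_if_generate:
  assumes p: "\<bar>p\<bar> \<noteq> 1" and xy: "x \<in> carrier G" "y \<in> carrier G" and gen: "generate G {x, y} = carrier G"
  shows "\<not> p dvd det x y"
proof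
  assume det: "p dvd det x y"
  have key: "p dvd s \<and> p dvd t"
    if st: "p dvd s * \<alpha> x + t * \<beta> x" "p dvd s * \<alpha> y + t * \<beta> y" for s t
  proof -
    define K where "K = {g \<in> carrier G. p dvd s * \<alpha> g + t * \<beta> g}"
    have K: "g \<in> K \<longleftrightarrow> p dvd s * u + t * v" if "coords g u v" for g u v
    proof -
      have "[s * \<alpha> g + t * \<beta> g = s * u + t * v] (mod p)"
        using that unfolding coords_def by (intro cong_add cong_mult) auto
      then have "p dvd s * \<alpha> g + t * \<beta> g \<longleftrightarrow> p dvd s * u + t * v" by (rule cong_dvd_iff)
      then show ?thesis using that unfolding K_def coords_def by simp
    qed
    have "subgroup K G"
    proof (rule subgroupI)
      show "K \<subseteq> carrier G" by (auto simp: K_def)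
      show "K \<noteq> {}" using K[OF coords_one] by auto
      show "inv g \<in> K" if "g \<in> K" for g
      proof -
        have "coords g (\<alpha> g) (\<beta> g)" using that by (simp add: K_def coords_self)
        then have "inv g \<in> K \<longleftrightarrow> p dvd - (s * \<alpha> g + t * \<beta> g)"
          using K[OF coords_inv] by (simp add: algebra_simps)
        then show ?thesis using that by (simp add: K_def del: minus_add_distrib)
      qed
      show "g \<otimes> h \<in> K" if "g \<in> K" "h \<in> K" for g h
      proof -
        have "g \<in> carrier G" "h \<in> carrier G" using that by (auto simp: K_def)
        then have "g \<otimes> h \<in> K \<longleftrightarrow> p dvd (s * \<alpha> g + t * \<beta> g) + (s * \<alpha> h + t * \<beta> h)"
          using K[OF coords_mult[OF coords_self coords_self]] by (simp add: algebra_simps)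
        then show ?thesis using that by (simp add: K_def)
      qed
    qed
    moreover have "{x, y} \<subseteq> K" using xy st by (auto simp: K_def)
    ultimately have "carrier G \<subseteq> K" unfolding gen[symmetric] by (intro generate_subgroup_incl)
    then have "a \<in> K" "b \<in> K" by auto
    then show ?thesis using K[OF coords_a] K[OF coords_b] by simp
  qed
  have "p dvd - \<beta> x \<and> p dvd \<alpha> x"
    using det by (intro key) (simp_all add: det_def algebra_simps)
  moreover have "p dvd \<beta> y \<and> p dvd - \<alpha> y"
  proof (rule key)
    show "p dvd \<beta> y * \<alpha> x + - \<alpha> y * \<beta> x" using det by (simp add: det_def algebra_simps)
  qed simp
  \<comment> \<open>Now both generators lie over the origin, so even the form
    \<open>\<alpha>\<close> itself, with coefficients 1 and 0, vanishes on them.\<close>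
  ultimately have "p dvd 1 \<and> p dvd 0" by (intro key) auto
  with p show False by (metis abs_dvd_iff zdvd1_eq)
qed

text \<open>The generating pairs \<open>(a, b)\<close> and \<open>((a b\<^sup>2)\<^sup>-\<^sup>1, (a b\<^sup>3)\<^sup>2)\<close> use the slopes
  \<open>0, \<infinity>, 1\<close> and \<open>2, 3, 4\<close>.\<close>

lemma beauville_group_if_separated:
  assumes p: "prime p" "p \<ge> 5" and odd: "odd (order G)"
    and sep: "\<And>g h i j k l. \<lbrakk>g \<in> carrier G; h \<in> carrier G; k \<in> carrier G; l \<in> carrier G;
      \<not> p dvd det g h; conjugate G (g [^] (i::nat)) k = conjugate G (h [^] (j::nat)) l\<rbrakk>
      \<Longrightarrow> g [^] i = \<one>"
  shows "beauville_group G"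
proof -
  define u where "u = a \<otimes> b [^] (2::nat)"
  define v where "v = a \<otimes> b [^] (3::nat)"
  define x where "x = inv u"
  define y where "y = v [^] (2::nat)"
  have u: "coords u 1 2" and v: "coords v 1 3"
    using coords_mult[OF coords_a coords_pow[OF coords_b, of 2]]
      coords_mult[OF coords_a coords_pow[OF coords_b, of 3]] by (simp_all add: u_def v_def)
  then have uv [simp]: "u \<in> carrier G" "v \<in> carrier G" by (auto simp: coords_def)
  then have xy [simp]: "x \<in> carrier G" "y \<in> carrier G" by (auto simp: x_def y_def)
  have c1: "coords (a \<otimes> b) 1 1" using coords_mult[OF coords_a coords_b] by simp
  \<comment> \<open>The inverse and the square are chosen so that the product also gets a new slope:
    -(1,2) + 2(1,3) = (1,4).\<close>
  have cx: "coords x (-1) (-2)" using coords_inv[OF u] by (simp add: x_def)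
  have cy: "coords y 2 6" using coords_pow[OF v, of 2] by (simp add: y_def)
  have c2: "coords (x \<otimes> y) 1 4" using coords_mult[OF cx cy] by simp
  have gen: "generate G {x, y} = carrier G"
  proof (rule generate_eqI)
    let ?H = "generate G {x, y}"
    have sub: "subgroup ?H G" by (intro generate_is_subgroup) auto
    have xH: "x \<in> ?H" and yH: "y \<in> ?H" by (auto intro: generate.incl)
    then have uH: "u \<in> ?H" using subgroup.m_inv_closed[OF sub xH] by (simp add: x_def)
    have powH: "g [^] (n::nat) \<in> ?H" if "g \<in> ?H" for g n
      using that sub
      by (induction n) (auto simp: subgroup.one_closed intro: subgroup.m_closed)
    \<comment> \<open>In a group of odd order an element is a power of its square, so
      \<open>v\<close> can be recovered from \<open>y\<close>.\<close>
    obtain m where m: "order G = 2 * m + 1" using odd by (auto elim: oddE)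
    have "v = v [^] (1 + order G)" by (simp add: nat_pow_mult[symmetric] pow_order_eq_1)
    also have "1 + order G = 2 * (m + 1)" by (simp add: m)
    also have "v [^] \<dots> = y [^] (m + 1)" unfolding y_def by (rule nat_pow_pow[symmetric]) simp
    finally have vH: "v \<in> ?H" using powH[OF yH, of "m + 1"] by (simp only:)
    have "u \<otimes> b = v" by (simp add: u_def v_def m_assoc numeral_eq_Suc)
    then have "b = inv u \<otimes> v" by (simp add: inv_solve_left)
    then show bH: "b \<in> ?H" using xH vH sub by (simp add: x_def subgroup.m_closed)
    have "a = u \<otimes> inv (b [^] (2::nat))" by (simp add: u_def m_assoc)
    then show "a \<in> ?H"
      using subgroup.m_closed[OF sub uH subgroup.m_inv_closed[OF sub powH[OF bH, of 2]]] by simp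
  qed auto
  \<comment> \<open>The set contains all nine determinants between the vectors (1,0), (0,1), (1,1)
    and (-1,-2), (2,6), (1,4). The value 6 is not excluded by size when p = 5, hence its
    factorisation as 2 * 3.\<close>
  have ndvd: "\<not> p dvd c" if "c \<in> {1,-1,2,-2,3,4,6}" for c
  proof
    assume "p dvd c"
    moreover have "\<bar>c\<bar> \<in> {1, 2, 3, 4, 2 * 3}" using that by auto
    ultimately have "p dvd 1 \<or> p dvd 2 \<or> p dvd 3 \<or> p dvd 4 \<or> p dvd 2 * 3"
      by (metis dvd_abs_iff empty_iff insert_iff)
    then have "p dvd 1 \<or> p dvd 2 \<or> p dvd 3 \<or> p dvd 4"
      using p(1) by (metis prime_dvd_mult_iff)
    then have "p \<le> 4" by (auto dest: zdvd_imp_le)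
    with p show False by simp
  qed
  have det: "\<not> p dvd det g h" if "g \<in> {a, b, a \<otimes> b}" "h \<in> {x, y, x \<otimes> y}" for g h
  proof -
    have "coords g 1 0 \<or> coords g 0 1 \<or> coords g 1 1"
      using that(1) coords_a coords_b c1 by auto
    then obtain s t where g: "coords g s t" "(s, t) \<in> {(1,0), (0,1), (1,1)}" by blast
    have "coords h (-1) (-2) \<or> coords h 2 6 \<or> coords h 1 4"
      using that(2) cx cy c2 by auto
    then obtain s' t' where h: "coords h s' t'" "(s', t') \<in> {(-1,-2), (2,6), (1,4)}" by blast
    have "s * t' - s' * t \<in> {1,-1,2,-2,3,4,6}" using g(2) h(2) by auto
    then have "\<not> p dvd s * t' - s' * t" by (rule ndvd)
    then show ?thesis using cong_dvd_iff[OF det_cong[OF g(1) h(1)]] by simp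
  qed
  \<comment> \<open>Exponents in \<open>Sigma_set\<close> start at 1, so the identity is obtained
    with exponent \<open>order G\<close>.\<close>
  have "order G > 0" using odd by (auto intro: Nat.gr0I)
  then have one: "\<one> \<in> Sigma_set G s t" if "s \<in> carrier G" for s t
    unfolding mem_Sigma_set using that
    by (intro bexI[of _ s] bexI[of _ "order G"] bexI[of _ \<one>]) (auto simp: pow_order_eq_1)
  have "Sigma_set G a b \<inter> Sigma_set G x y = {\<one>}"
  proof (intro equalityI subsetI)
    fix s assume "s \<in> Sigma_set G a b \<inter> Sigma_set G x y"
    then obtain g i k h j l where
      s: "g \<in> {a, b, a \<otimes> b}" "h \<in> {x, y, x \<otimes> y}" "k \<in> carrier G" "l \<in> carrier G"
        "s = conjugate G (g [^] (i::nat)) k" "s = conjugate G (h [^] (j::nat)) l"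
      unfolding mem_Sigma_set Int_iff by blast
    have "g [^] i = \<one>"
      using s by (intro sep[of g h k l i j] det) auto
    then show "s \<in> {\<one>}" using s by simp
  next
    fix s assume "s \<in> {\<one>}"
    then show "s \<in> Sigma_set G a b \<inter> Sigma_set G x y" using one by simp
  qed
  then have "beauville_structure G a b x y"
    using gen generate_ab by (simp add: beauville_structure_def)
  then show ?thesis using finite is_group unfolding beauville_group_def by blast
qed

end

text \<open>Modulo 3 a non-zero \<open>b\<close> is its own inverse, so the product \<open>a * b\<close> serves as the slope
  \<open>a / b\<close>.\<close>

lemma slopes_mod_3:
  fixes a b c d :: int
  assumes "\<not> 3 dvd a * d - c * b"
  shows "\<exists>m. \<forall>s\<in>{0, 1, 2}. s \<noteq> m \<longrightarrow> (\<not> 3 dvd b \<and> a * b mod 3 = s) \<or> (\<not> 3 dvd d \<and> c * d mod 3 = s)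
    \<or> (\<not> 3 dvd b + d \<and> (a + c) * (b + d) mod 3 = s)"
proof -
  \<comment> \<open>Only residues matter. With all quantifiers bounded, including the one for the
    missed slope \<open>m\<close>, the claim is a finite check; the rest of the proof transfers it
    to arbitrary integers.\<close>
  have *: "\<forall>a\<in>{0, 1, 2}. \<forall>b\<in>{0, 1, 2}. \<forall>c\<in>{0, 1, 2}. \<forall>d\<in>{0, 1, 2::int}. \<not> 3 dvd a * d - c * b \<longrightarrow>
    (\<exists>m\<in>{0, 1, 2}. \<forall>s\<in>{0, 1, 2}. s \<noteq> m \<longrightarrow> (\<not> 3 dvd b \<and> a * b mod 3 = s) \<or> (\<not> 3 dvd d \<and> c * d mod 3 = s)
    \<or> (\<not> 3 dvd b + d \<and> (a + c) * (b + d) mod 3 = s))"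
    by simp
  have r: "x mod 3 \<in> {0, 1, 2}" for x :: int
    using pos_mod_bound[of 3 x] pos_mod_sign[of 3 x] by auto
  have **: "\<not> 3 dvd a mod 3 * (d mod 3) - c mod 3 * (b mod 3) \<longrightarrow>
    (\<exists>m\<in>{0, 1, 2}. \<forall>s\<in>{0, 1, 2}. s \<noteq> m \<longrightarrow> (\<not> 3 dvd b mod 3 \<and> a mod 3 * (b mod 3) mod 3 = s)
    \<or> (\<not> 3 dvd d mod 3 \<and> c mod 3 * (d mod 3) mod 3 = s)
    \<or> (\<not> 3 dvd b mod 3 + d mod 3 \<and> (a mod 3 + c mod 3) * (b mod 3 + d mod 3) mod 3 = s))"
    using *[THEN bspec, OF r[of a], THEN bspec, OF r[of b], THEN bspec, OF r[of c], THEN bspec, OF r[of d]] .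
  have 1: "3 dvd a mod 3 * (d mod 3) - c mod 3 * (b mod 3) \<longleftrightarrow> 3 dvd a * d - c * b"
    "3 dvd b mod 3 + d mod 3 \<longleftrightarrow> 3 dvd b + d"
    by (intro cong_dvd_iff cong_diff cong_add cong_mult; simp)+
  have 2: "a mod 3 * (b mod 3) mod 3 = a * b mod 3" "c mod 3 * (d mod 3) mod 3 = c * d mod 3"
    "(a mod 3 + c mod 3) * (b mod 3 + d mod 3) mod 3 = (a + c) * (b + d) mod 3"
    unfolding cong_def[symmetric] by (intro cong_add cong_mult; simp)+
  have 3: "3 dvd b mod 3 \<longleftrightarrow> 3 dvd b" "3 dvd d mod 3 \<longleftrightarrow> 3 dvd d"
    by (simp_all add: dvd_mod_iff)
  from **[unfolded 1 2 3, rule_format, OF assms] show ?thesis by (elim bexE) (rule exI)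
qed

text \<open>The product of the coordinates encodes the slope of a line with \<open>\<beta>\<close>
  non-zero. The assumption \<open>common\<close> is confined to such lines so that one exceptional
  line can be left aside.\<close>

lemma (in plane_coordinates) not_beauville_group_if_common:
  assumes p: "p = 3"
    and common: "\<And>g h. \<lbrakk>g \<in> carrier G; h \<in> carrier G; \<not> 3 dvd \<beta> g; \<not> 3 dvd \<beta> h;
      [\<alpha> g * \<beta> g = \<alpha> h * \<beta> h] (mod 3)\<rbrakk>
      \<Longrightarrow> \<exists>i\<in>{1..order G}. \<exists>j\<in>{1..order G}. \<exists>k\<in>carrier G. \<exists>l\<in>carrier G.
        conjugate G (g [^] i) k = conjugate G (h [^] j) l \<and> conjugate G (g [^] i) k \<noteq> \<one>"
  shows "\<not> beauville_group G"
proof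
  assume "beauville_group G"
  then obtain x1 y1 x2 y2 where b: "beauville_structure G x1 y1 x2 y2"
    by (auto simp: beauville_group_def)
  have slopes: "\<exists>m. \<forall>s\<in>{0, 1, 2}. s \<noteq> m \<longrightarrow>
      (\<exists>g\<in>{x, y, x \<otimes> y}. g \<in> carrier G \<and> \<not> 3 dvd \<beta> g \<and> \<alpha> g * \<beta> g mod 3 = s)"
    if xy: "x \<in> carrier G" "y \<in> carrier G" and gen: "generate G {x, y} = carrier G" for x y
  proof -
    have "\<not> 3 dvd det x y" using not_dvd_det_if_generate[OF _ xy gen] p by simp
    then obtain m where m: "\<forall>s\<in>{0, 1, 2}. s \<noteq> m \<longrightarrow>
      (\<not> 3 dvd \<beta> x \<and> \<alpha> x * \<beta> x mod 3 = s) \<or> (\<not> 3 dvd \<beta> y \<and> \<alpha> y * \<beta> y mod 3 = s)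
      \<or> (\<not> 3 dvd \<beta> x + \<beta> y \<and> (\<alpha> x + \<alpha> y) * (\<beta> x + \<beta> y) mod 3 = s)"
      using slopes_mod_3 unfolding det_def by blast
    have d: "3 dvd \<beta> x + \<beta> y \<longleftrightarrow> 3 dvd \<beta> (x \<otimes> y)"
      using \<beta>_mult[OF xy] p by (metis cong_dvd_iff)
    have e: "(\<alpha> x + \<alpha> y) * (\<beta> x + \<beta> y) mod 3 = \<alpha> (x \<otimes> y) * \<beta> (x \<otimes> y) mod 3"
      using \<alpha>_mult[OF xy] \<beta>_mult[OF xy] p unfolding cong_def by (metis mod_mult_eq)
    have m': "s \<noteq> m \<Longrightarrow> s \<in> {0, 1, 2} \<Longrightarrow>
      (\<not> 3 dvd \<beta> x \<and> \<alpha> x * \<beta> x mod 3 = s) \<or> (\<not> 3 dvd \<beta> y \<and> \<alpha> y * \<beta> y mod 3 = s)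
      \<or> (\<not> 3 dvd \<beta> (x \<otimes> y) \<and> \<alpha> (x \<otimes> y) * \<beta> (x \<otimes> y) mod 3 = s)" for s
      using m[rule_format, of s] unfolding d e .
    show ?thesis
    proof (intro exI[of _ m] ballI impI)
      fix s :: int assume "s \<in> {0, 1, 2}" "s \<noteq> m"
      from m'[OF this(2,1)] xy
      show "\<exists>g\<in>{x, y, x \<otimes> y}. g \<in> carrier G \<and> \<not> 3 dvd \<beta> g \<and> \<alpha> g * \<beta> g mod 3 = s"
        by (elim disjE) simp_all
    qed
  qed
  have "x1 \<in> carrier G" "y1 \<in> carrier G" "generate G {x1, y1} = carrier G"
    using b by (simp_all add: beauville_structure_def)
  from slopes[OF this] obtain m1 where m1: "\<forall>s\<in>{0, 1, 2}. s \<noteq> m1 \<longrightarrow>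
      (\<exists>g\<in>{x1, y1, x1 \<otimes> y1}. g \<in> carrier G \<and> \<not> 3 dvd \<beta> g \<and> \<alpha> g * \<beta> g mod 3 = s)" ..
  have "x2 \<in> carrier G" "y2 \<in> carrier G" "generate G {x2, y2} = carrier G"
    using b by (simp_all add: beauville_structure_def)
  from slopes[OF this] obtain m2 where m2: "\<forall>s\<in>{0, 1, 2}. s \<noteq> m2 \<longrightarrow>
      (\<exists>g\<in>{x2, y2, x2 \<otimes> y2}. g \<in> carrier G \<and> \<not> 3 dvd \<beta> g \<and> \<alpha> g * \<beta> g mod 3 = s)" ..
  \<comment> \<open>Two missed slopes cannot exhaust the three available ones.\<close>
  have "\<exists>s\<in>{0, 1, 2}. s \<noteq> m1 \<and> s \<noteq> m2" by (cases "m1 = 0"; cases "m2 = 0"; cases "m1 = 1") auto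
  then obtain s where s: "s \<in> {0, 1, 2}" "s \<noteq> m1" "s \<noteq> m2" by blast
  from m1[rule_format, OF s(1,2)] obtain g where g: "g \<in> {x1, y1, x1 \<otimes> y1}"
    "g \<in> carrier G" "\<not> 3 dvd \<beta> g" "\<alpha> g * \<beta> g mod 3 = s" by (elim bexE conjE)
  from m2[rule_format, OF s(1,3)] obtain h where h: "h \<in> {x2, y2, x2 \<otimes> y2}"
    "h \<in> carrier G" "\<not> 3 dvd \<beta> h" "\<alpha> h * \<beta> h mod 3 = s" by (elim bexE conjE)
  have "[\<alpha> g * \<beta> g = \<alpha> h * \<beta> h] (mod 3)" using g h by (simp add: cong_def)
  from common[OF g(2) h(2) g(3) h(3) this] obtain i j k l where
    "i \<in> {1..order G}" "j \<in> {1..order G}" "k \<in> carrier G" "l \<in> carrier G"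
    "conjugate G (g [^] i) k = conjugate G (h [^] j) l" "conjugate G (g [^] i) k \<noteq> \<one>" by blast
  with g(1) h(1) have "conjugate G (g [^] i) k \<in> Sigma_set G x1 y1 \<inter> Sigma_set G x2 y2"
    unfolding mem_Sigma_set Int_iff by blast
  with b \<open>conjugate G (g [^] i) k \<noteq> \<one>\<close> show False by (simp add: beauville_structure_def)
qed


section \<open>A model of the first group\<close>

lemma int_cong_if_diff_eq: "a - b = m * k \<Longrightarrow> [a = b] (mod m)" for a b m :: int
  by (simp add: cong_iff_dvd_diff)

lemma twice_sum_lessThan: "2 * (\<Sum>k<n. int k) = int n * (int n - 1)"
  by (induction n) (simp_all add: algebra_simps)

lemma six_times_sum_squares_lessThan:
  "6 * (\<Sum>k<n. (int k)\<^sup>2) = int n * (int n - 1) * (2 * int n - 1)"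
  by (induction n) (simp_all add: algebra_simps power2_eq_square)

definition red2 :: "nat \<Rightarrow> int \<Rightarrow> int \<Rightarrow> int \<times> int" where
  "red2 p a b = (a mod (int p)\<^sup>2, b mod (int p)\<^sup>2)"

text \<open>The pair \<open>(a, b)\<close> stands for \<open>x\<^sup>a y\<^sup>b\<close>; the twist comes from \<open>y x y\<^sup>-\<^sup>1 = x\<^sup>1\<^sup>-\<^sup>p\<close>.\<close>

definition M2 :: "nat \<Rightarrow> (int \<times> int) monoid" where
  "M2 p = \<lparr>carrier = {0..<(int p)\<^sup>2} \<times> {0..<(int p)\<^sup>2},
     monoid.mult = (\<lambda>(a, b) (c, d). red2 p (a + c - int p * b * c) (b + d)),
     monoid.one = (0, 0)\<rparr>"

locale odd_prime =
  fixes p :: nat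
  assumes prime: "prime p" and gt_2: "p > 2"
begin

lemma p_pos: "int p > 0" using gt_2 by simp

lemma prime_int: "prime (int p)" using prime by simp

lemma odd_p: "odd p" using prime gt_2 by (simp add: prime_odd_nat)

lemma red2_eq_iff:
  "red2 p a b = red2 p c d \<longleftrightarrow> [a = c] (mod (int p)\<^sup>2) \<and> [b = d] (mod (int p)\<^sup>2)"
  by (simp add: red2_def cong_def)

lemma red2_closed [simp]: "red2 p a b \<in> carrier (M2 p)"
  using p_pos by (simp add: M2_def red2_def)

lemma red2_self: "g \<in> carrier (M2 p) \<Longrightarrow> red2 p (fst g) (snd g) = g"
  by (auto simp: M2_def red2_def)

text \<open>Passes from carrier elements to \<open>red2\<close> of unrestricted integers, turning
  group laws into polynomial congruences; used as an elimination rule on membership facts.\<close>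

lemma ball_M2:
  assumes "\<And>a b. Q (red2 p a b)" and "g \<in> carrier (M2 p)"
  shows "Q g"
  using assms(1)[of "fst g" "snd g"] red2_self[OF assms(2)] by simp

text \<open>The twist is linear in \<open>b\<close> because (1 - p)^b is congruent to 1 - p b modulo
  p^2.\<close>

lemma mult_red2 [simp]:
  "red2 p a b \<otimes>\<^bsub>M2 p\<^esub> red2 p c d = red2 p (a + c - int p * b * c) (b + d)"
proof -
  have "red2 p a b \<otimes>\<^bsub>M2 p\<^esub> red2 p c d = red2 p (a mod (int p)\<^sup>2 + c mod (int p)\<^sup>2 -
      int p * (b mod (int p)\<^sup>2) * (c mod (int p)\<^sup>2)) (b mod (int p)\<^sup>2 + d mod (int p)\<^sup>2)"
    by (simp add: M2_def red2_def)
  also have "\<dots> = red2 p (a + c - int p * b * c) (b + d)"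
    unfolding red2_eq_iff by (intro conjI cong_add cong_diff cong_mult) simp_all
  finally show ?thesis .
qed

lemma one_M2: "\<one>\<^bsub>M2 p\<^esub> = red2 p 0 0"
  by (simp add: M2_def red2_def)

sublocale M2: group "M2 p"
proof (rule groupI)
  show "\<one>\<^bsub>M2 p\<^esub> \<in> carrier (M2 p)" by (simp add: one_M2)
next
  fix x y assume "x \<in> carrier (M2 p)" "y \<in> carrier (M2 p)"
  then show "x \<otimes>\<^bsub>M2 p\<^esub> y \<in> carrier (M2 p)"
    by (elim ball_M2[rotated]) simp
next
  fix x y z assume "x \<in> carrier (M2 p)" "y \<in> carrier (M2 p)" "z \<in> carrier (M2 p)"
  then show "x \<otimes>\<^bsub>M2 p\<^esub> y \<otimes>\<^bsub>M2 p\<^esub> z = x \<otimes>\<^bsub>M2 p\<^esub> (y \<otimes>\<^bsub>M2 p\<^esub> z)"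
  proof (elim ball_M2[rotated])
    fix a b c d e f
    show "red2 p a b \<otimes>\<^bsub>M2 p\<^esub> red2 p c d \<otimes>\<^bsub>M2 p\<^esub> red2 p e f =
      red2 p a b \<otimes>\<^bsub>M2 p\<^esub> (red2 p c d \<otimes>\<^bsub>M2 p\<^esub> red2 p e f)"
      unfolding mult_red2 red2_eq_iff
      \<comment> \<open>The two bracketings differ by the term in which the twist is applied twice;
        it carries a factor p^2.\<close>
      by (rule conjI[OF int_cong_if_diff_eq[where k = "- b * d * e"] int_cong_if_diff_eq[where k = 0]])
         (simp_all add: algebra_simps power2_eq_square)
  qed
next
  fix x assume "x \<in> carrier (M2 p)"
  then show "\<exists>y\<in>carrier (M2 p). y \<otimes>\<^bsub>M2 p\<^esub> x = \<one>\<^bsub>M2 p\<^esub>"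
  proof (elim ball_M2[rotated])
    fix a b
    have "red2 p (- a - int p * a * b) (- b) \<otimes>\<^bsub>M2 p\<^esub> red2 p a b = \<one>\<^bsub>M2 p\<^esub>"
      by (simp add: one_M2 algebra_simps)
    then show "\<exists>y\<in>carrier (M2 p). y \<otimes>\<^bsub>M2 p\<^esub> red2 p a b = \<one>\<^bsub>M2 p\<^esub>"
      by (rule bexI) simp
  qed
next
  fix x assume "x \<in> carrier (M2 p)"
  then show "\<one>\<^bsub>M2 p\<^esub> \<otimes>\<^bsub>M2 p\<^esub> x = x"
    by (elim ball_M2[rotated]) (simp add: one_M2)
qed

lemma inv_red2 [simp]: "inv\<^bsub>M2 p\<^esub> red2 p a b = red2 p (- a - int p * a * b) (- b)"
  by (rule M2.inv_equality) (simp_all add: one_M2 algebra_simps)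

text \<open>Appending a further factor to a k-th power moves x^a past y^(k b), which contributes the
  summand with index k.\<close>

lemma pow_red2:
  "red2 p a b [^]\<^bsub>M2 p\<^esub> n = red2 p (int n * a - int p * a * b * (\<Sum>k<n. int k)) (int n * b)"
  by (induction n) (simp_all add: one_M2 algebra_simps)

lemma conjugate_red2:
  "conjugate (M2 p) (red2 p a b) (red2 p c d) = red2 p (a + int p * (d * a - b * c)) b"
  by (simp add: conjugate_def algebra_simps)

lemma order_M2: "order (M2 p) = p ^ 4"
proof -
  have "nat ((int p)\<^sup>2) = p\<^sup>2" by (simp add: nat_power_eq)
  then show ?thesis by (simp add: order_def M2_def card_cartesian_product flip: power_add)
qed

lemma generate_M2: "generate (M2 p) {red2 p 1 0, red2 p 0 1} = carrier (M2 p)"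
proof
  let ?H = "generate (M2 p) {red2 p 1 0, red2 p 0 1}"
  have sub: "subgroup ?H (M2 p)" by (intro M2.generate_is_subgroup) auto
  then show "?H \<subseteq> carrier (M2 p)" by (rule subgroup.subset)
  have pow: "g [^]\<^bsub>M2 p\<^esub> (n::nat) \<in> ?H" if "g \<in> ?H" for g n
    using that sub by (induction n) (auto simp: subgroup.one_closed intro: subgroup.m_closed)
  show "carrier (M2 p) \<subseteq> ?H"
  proof
    fix g assume g: "g \<in> carrier (M2 p)"
    then have "g = red2 p 1 0 [^]\<^bsub>M2 p\<^esub> nat (fst g) \<otimes>\<^bsub>M2 p\<^esub> red2 p 0 1 [^]\<^bsub>M2 p\<^esub> nat (snd g)"
      by (auto simp: pow_red2) (auto simp: M2_def red2_def)
    then show "g \<in> ?H"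
      using subgroup.m_closed[OF sub pow pow] by (metis generate.incl insertI1 insertI2)
  qed
qed

lemma cong_mod_p_if_square: "[a = b] (mod (int p)\<^sup>2) \<Longrightarrow> [a = b] (mod int p)"
  unfolding power2_eq_square by (rule cong_dvd_modulus[OF _ dvd_triv_left])

lemma red2_coords: "[fst (red2 p a b) = a] (mod int p)" "[snd (red2 p a b) = b] (mod int p)"
  by (auto simp: red2_def intro: cong_mod_p_if_square)

text \<open>The twist is a multiple of p, so the exponents of x and y become additive modulo
  p.\<close>

sublocale M2: plane_coordinates "M2 p" "int p" fst snd "red2 p 1 0" "red2 p 0 1"
proof
  fix g h assume "g \<in> carrier (M2 p)" "h \<in> carrier (M2 p)"
  then have gh: "g \<otimes>\<^bsub>M2 p\<^esub> h = red2 p (fst g + fst h - int p * snd g * fst h) (snd g + snd h)"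
    by (simp add: M2_def case_prod_beta)
  have "[fst g + fst h - int p * snd g * fst h = fst g + fst h] (mod int p)"
    by (rule int_cong_if_diff_eq[where k = "- snd g * fst h"]) simp
  then show "[fst (g \<otimes>\<^bsub>M2 p\<^esub> h) = fst g + fst h] (mod int p)"
    unfolding gh by (rule cong_trans[OF red2_coords(1)])
  show "[snd (g \<otimes>\<^bsub>M2 p\<^esub> h) = snd g + snd h] (mod int p)"
    unfolding gh by (rule red2_coords(2))
qed (simp_all add: red2_coords generate_M2, simp add: M2_def)

text \<open>The correction contains p times n (n - 1) / 2. As p is odd and divides n, that is a
  multiple of p^2, so these powers are computed coordinatewise.\<close>

lemma pow_red2_if_dvd:
  assumes "int p dvd int n"
  shows "red2 p a b [^]\<^bsub>M2 p\<^esub> n = red2 p (int n * a) (int n * b)"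
proof -
  have "int p dvd 2 * (\<Sum>k<n. int k)" using assms by (simp add: twice_sum_lessThan)
  then have "int p dvd (\<Sum>k<n. int k)"
    using prime_int gt_2 by (auto simp: prime_dvd_mult_iff dest: zdvd_imp_le)
  then obtain t where t: "(\<Sum>k<n. int k) = int p * t" by blast
  show ?thesis
    unfolding pow_red2 red2_eq_iff t
    by (rule conjI[OF int_cong_if_diff_eq[where k = "- a * b * t"] int_cong_if_diff_eq[where k = 0]]) (simp_all add: power2_eq_square)
qed

text \<open>Conjugation changes the first exponent by p times a combination of the two exponents;
  when these are multiples of p, the change is zero modulo p^2.\<close>

lemma conjugate_pow_red2_if_dvd:
  assumes "int p dvd int n" and "k \<in> carrier (M2 p)"
  shows "conjugate (M2 p) (red2 p a b [^]\<^bsub>M2 p\<^esub> n) k = red2 p (int n * a) (int n * b)"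
  using assms(2)
proof (elim ball_M2[rotated])
  fix c d
  obtain m where m: "int n = int p * m" using assms(1) by blast
  show "conjugate (M2 p) (red2 p a b [^]\<^bsub>M2 p\<^esub> n) (red2 p c d) = red2 p (int n * a) (int n * b)"
    unfolding pow_red2_if_dvd[OF assms(1)] conjugate_red2 red2_eq_iff m
    by (rule conjI[OF int_cong_if_diff_eq[where k = "d * m * a - m * b * c"] int_cong_if_diff_eq[where k = 0]])
       (simp_all add: algebra_simps power2_eq_square)
qed

lemma beauville_M2:
  assumes "p \<ge> 5"
  shows "beauville_group (M2 p)"
proof (rule M2.beauville_group_if_separated)
  show "odd (order (M2 p))" using odd_p by (simp add: order_M2)
  fix g h k l and i j :: nat
  assume g: "g \<in> carrier (M2 p)" and h: "h \<in> carrier (M2 p)"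
    and kl: "k \<in> carrier (M2 p)" "l \<in> carrier (M2 p)"
    and det: "\<not> int p dvd M2.det g h"
    and eq: "conjugate (M2 p) (g [^]\<^bsub>M2 p\<^esub> i) k = conjugate (M2 p) (h [^]\<^bsub>M2 p\<^esub> j) l"
  have dvd: "int p dvd int i" "int p dvd int j"
    using M2.dvd_exponents_if_conjugate_pow_eq[OF prime_int g h kl det eq] by auto
  define a b where ab: "a = fst g" "b = snd g"
  have gab: "g = red2 p a b" using red2_self[OF g] by (simp add: ab)
  define c d where cd: "c = fst h" "d = snd h"
  have hcd: "h = red2 p c d" using red2_self[OF h] by (simp add: cd)
  have "red2 p (int i * a) (int i * b) = red2 p (int j * c) (int j * d)"
    using eq kl dvd by (simp add: gab hcd conjugate_pow_red2_if_dvd)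
  \<comment> \<open>With p dividing i and j, both sides are coordinatewise powers, so the
    elimination by Cramer's rule can be repeated modulo p^2. The determinant is still a unit there,
    and i is a multiple of p^2.\<close>
  then have e: "(int p)\<^sup>2 dvd int i * a - int j * c" "(int p)\<^sup>2 dvd int i * b - int j * d"
    by (auto simp: red2_eq_iff cong_iff_dvd_diff)
  have "(int p)\<^sup>2 dvd (int i * a - int j * c) * d - (int i * b - int j * d) * c"
    by (intro dvd_diff dvd_mult2 e)
  also have "\<dots> = int i * M2.det g h" by (simp add: M2.det_def ab cd algebra_simps)
  finally have "(int p)\<^sup>2 dvd int i * M2.det g h" .
  moreover have "coprime ((int p)\<^sup>2) (M2.det g h)"
    using det prime_int by (simp add: prime_imp_coprime)
  ultimately have "(int p)\<^sup>2 dvd int i" by (simp add: coprime_dvd_mult_left_iff)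
  then show "g [^]\<^bsub>M2 p\<^esub> i = \<one>\<^bsub>M2 p\<^esub>"
    unfolding gab pow_red2_if_dvd[OF dvd(1)] one_M2 red2_eq_iff by (simp add: cong_0_iff)
qed (use assms prime_int in auto)

lemma not_comm_M2: "\<not> comm_group (M2 p)"
proof
  assume "comm_group (M2 p)"
  then interpret C: comm_group "M2 p" .
  have "red2 p 1 0 \<otimes>\<^bsub>M2 p\<^esub> red2 p 0 1 = red2 p 0 1 \<otimes>\<^bsub>M2 p\<^esub> red2 p 1 0"
    by (rule C.m_comm) simp_all
  then have "(int p)\<^sup>2 dvd int p" by (simp add: red2_eq_iff cong_iff_dvd_diff)
  then have "(int p)\<^sup>2 \<le> int p" using p_pos by (rule zdvd_imp_le)
  then show False using gt_2 by (simp add: power2_eq_square)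
qed

end

text \<open>A line over the field with three elements has only two non-zero vectors, opposite to
  each other. The factor 2 stands for -1 because it will become a natural exponent.\<close>

lemma equal_slopes_mod_3:
  fixes a b c d :: int
  assumes "\<not> 3 dvd b" "\<not> 3 dvd d" "[a * b = c * d] (mod 3)"
  obtains "[a = c] (mod 3)" "[b = d] (mod 3)" | "[a = 2 * c] (mod 3)" "[b = 2 * d] (mod 3)"
proof (cases "[b = d] (mod 3)")
  case True
  then have "[a * b = c * b] (mod 3)" 
    using assms(3) by (meson cong_refl cong_mult cong_sym cong_trans)
  moreover have "coprime b 3" using prime_imp_coprime[OF _ assms(1)] by (simp add: coprime_commute)
  ultimately show ?thesis using that(1) True by (simp add: cong_mult_rcancel)
next
  case False
  then have b: "[b = 2 * d] (mod 3)"
    using assms(1,2) unfolding cong_def dvd_eq_mod_eq_0 by presburger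
  have "[a * b = 2 * c * b] (mod 3)"
  proof -
    have "[2 * c * b = 2 * c * (2 * d)] (mod 3)" using b by (intro cong_mult) auto
    also have "[2 * c * (2 * d) = c * d] (mod 3)" by (rule int_cong_if_diff_eq[where k = "c * d"]) simp
    finally show ?thesis using assms(3) by (meson cong_sym cong_trans)
  qed
  moreover have "coprime b 3" using prime_imp_coprime[OF _ assms(1)] by (simp add: coprime_commute)
  ultimately show ?thesis using that(2) b by (simp add: cong_mult_rcancel)
qed

lemma odd_prime_3: "odd_prime 3"
  by unfold_locales simp_all

lemma not_beauville_M2_3: "\<not> beauville_group (M2 3)"
proof -
  interpret odd_prime 3 by (rule odd_prime_3)
  show ?thesis
  proof (rule M2.not_beauville_group_if_common)
    fix g h assume g: "g \<in> carrier (M2 3)" and h: "h \<in> carrier (M2 3)"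
      and nd: "\<not> 3 dvd snd g" "\<not> 3 dvd snd h" and slope: "[fst g * snd g = fst h * snd h] (mod 3)"
    define a b where ab: "a = fst g" "b = snd g"
  have gab: "g = red2 3 a b" using red2_self[OF g] by (simp add: ab)
    define c d where cd: "c = fst h" "d = snd h"
  have hcd: "h = red2 3 c d" using red2_self[OF h] by (simp add: cd)
    \<comment> \<open>Cubes therefore depend only on the image in the plane.\<close>
    have cong9: "[3 * u = 3 * v] (mod 3\<^sup>2)" if uv: "[u = v] (mod 3)" for u v :: int
    proof -
      obtain k where "u - v = 3 * k" using uv unfolding cong_iff_dvd_diff by (rule dvdE)
      then show ?thesis by (intro int_cong_if_diff_eq[where k = k]) simp
    qed
    have pow: "g [^]\<^bsub>M2 3\<^esub> (3::nat) = red2 3 (3 * a) (3 * b)"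
      "h [^]\<^bsub>M2 3\<^esub> (3::nat) = red2 3 (3 * c) (3 * d)" "h [^]\<^bsub>M2 3\<^esub> (6::nat) = red2 3 (6 * c) (6 * d)"
      by (simp_all add: gab hcd pow_red2_if_dvd)
    \<comment> \<open>Exponent 3 serves equal images, and 6 serves opposite ones, h^6 being the
      inverse of h^3.\<close>
    have "\<exists>j\<in>{3, 6::nat}. g [^]\<^bsub>M2 3\<^esub> (3::nat) = h [^]\<^bsub>M2 3\<^esub> j"
      using nd slope unfolding ab[symmetric] cd[symmetric]
    proof (rule equal_slopes_mod_3)
      assume "[a = c] (mod 3)" "[b = d] (mod 3)"
      then have "g [^]\<^bsub>M2 3\<^esub> (3::nat) = h [^]\<^bsub>M2 3\<^esub> (3::nat)"
        using cong9 unfolding pow red2_eq_iff by simp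
      then show ?thesis by blast
    next
      assume "[a = 2 * c] (mod 3)" "[b = 2 * d] (mod 3)"
      then have "g [^]\<^bsub>M2 3\<^esub> (3::nat) = h [^]\<^bsub>M2 3\<^esub> (6::nat)"
        using cong9[of a "2 * c"] cong9[of b "2 * d"] unfolding pow red2_eq_iff by simp
      then show ?thesis by blast
    qed
    then obtain j where j: "j \<in> {3, 6::nat}" "g [^]\<^bsub>M2 3\<^esub> (3::nat) = h [^]\<^bsub>M2 3\<^esub> j" by blast
    have "\<not> 9 dvd 3 * b" using nd(1) unfolding ab(2)[symmetric] by presburger
    then have "g [^]\<^bsub>M2 3\<^esub> (3::nat) \<noteq> \<one>\<^bsub>M2 3\<^esub>"
      by (simp add: pow one_M2 red2_eq_iff cong_0_iff)
    moreover have "conjugate (M2 3) (g [^]\<^bsub>M2 3\<^esub> (3::nat)) \<one>\<^bsub>M2 3\<^esub> = g [^]\<^bsub>M2 3\<^esub> (3::nat)"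
      using g by (simp add: conjugate_def)
    ultimately show "\<exists>i\<in>{1..order (M2 3)}. \<exists>j\<in>{1..order (M2 3)}. \<exists>k\<in>carrier (M2 3). \<exists>l\<in>carrier (M2 3).
        conjugate (M2 3) (g [^]\<^bsub>M2 3\<^esub> i) k = conjugate (M2 3) (h [^]\<^bsub>M2 3\<^esub> j) l \<and>
        conjugate (M2 3) (g [^]\<^bsub>M2 3\<^esub> i) k \<noteq> \<one>\<^bsub>M2 3\<^esub>"
      using j by (intro bexI[of _ 3] bexI[of _ j] bexI[of _ "\<one>\<^bsub>M2 3\<^esub>"]) (auto simp: order_M2)
  qed simp
qed


section \<open>A model of the second group\<close>

definition red7 :: "nat \<Rightarrow> int \<Rightarrow> int \<Rightarrow> int \<Rightarrow> int \<Rightarrow> int \<times> int \<times> int \<times> int" where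
  "red7 p a b c d = (a mod int p, b mod int p, c mod int p, d mod int p)"

text \<open>The tuple \<open>(a, b, c, d)\<close> stands for \<open>w\<^sup>a x\<^sup>b y\<^sup>c z\<^sup>d\<close>. Conjugation by \<open>z\<^sup>d\<close> sends \<open>x\<close> to
  \<open>w\<^sup>-\<^sup>d x\<close> and \<open>y\<close> to \<open>w\<^sup>e x\<^sup>-\<^sup>d y\<close> with \<open>e = d (d - 1) / 2\<close>, and for odd \<open>p\<close> the factor
  \<open>(p + 1) div 2\<close> is the inverse of 2 modulo \<open>p\<close>.\<close>

definition M7 :: "nat \<Rightarrow> (int \<times> int \<times> int \<times> int) monoid" where
  "M7 p = \<lparr>carrier = {0..<int p} \<times> {0..<int p} \<times> {0..<int p} \<times> {0..<int p},
     monoid.mult = (\<lambda>(a, b, c, d) (a', b', c', d').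
       red7 p (a + a' - d * b' + int ((p + 1) div 2) * c' * d * (d - 1)) (b + b' - d * c') (c + c') (d + d')),
     monoid.one = (0, 0, 0, 0)\<rparr>"

context odd_prime
begin

definition half :: int where "half = int ((p + 1) div 2)"

lemma twice_half: "2 * half = int p + 1"
  using odd_p by (auto simp: half_def elim!: oddE)

lemma red7_eq_iff:
  "red7 p a b c d = red7 p a' b' c' d' \<longleftrightarrow>
    [a = a'] (mod int p) \<and> [b = b'] (mod int p) \<and> [c = c'] (mod int p) \<and> [d = d'] (mod int p)"
  by (simp add: red7_def cong_def)

lemma red7_closed [simp]: "red7 p a b c d \<in> carrier (M7 p)"
  using p_pos by (simp add: M7_def red7_def)

lemma red7_cases:
  assumes "g \<in> carrier (M7 p)"
  obtains a b c d where "g = (a, b, c, d)" "red7 p a b c d = g"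
  using assms by (cases g) (auto simp: M7_def red7_def)

lemma ball_M7:
  assumes "\<And>a b c d. Q (red7 p a b c d)" and "g \<in> carrier (M7 p)"
  shows "Q g"
  using assms(2)
proof (rule red7_cases)
  fix a b c d assume "red7 p a b c d = g"
  with assms(1)[of a b c d] show ?thesis by simp
qed

lemma mult_red7 [simp]:
  "red7 p a b c d \<otimes>\<^bsub>M7 p\<^esub> red7 p a' b' c' d' =
    red7 p (a + a' - d * b' + half * c' * d * (d - 1)) (b + b' - d * c') (c + c') (d + d')"
proof -
  have "red7 p a b c d \<otimes>\<^bsub>M7 p\<^esub> red7 p a' b' c' d' =
    red7 p (a mod int p + a' mod int p - (d mod int p) * (b' mod int p)
        + half * (c' mod int p) * (d mod int p) * (d mod int p - 1))
      (b mod int p + b' mod int p - (d mod int p) * (c' mod int p))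
      (c mod int p + c' mod int p) (d mod int p + d' mod int p)"
    by (simp add: M7_def red7_def half_def)
  also have "\<dots> = red7 p (a + a' - d * b' + half * c' * d * (d - 1)) (b + b' - d * c') (c + c') (d + d')"
    unfolding red7_eq_iff by (intro conjI cong_add cong_diff cong_mult) simp_all
  finally show ?thesis .
qed

lemma one_M7: "\<one>\<^bsub>M7 p\<^esub> = red7 p 0 0 0 0"
  by (simp add: M7_def red7_def)

sublocale M7: group "M7 p"
proof (rule groupI)
  show "\<one>\<^bsub>M7 p\<^esub> \<in> carrier (M7 p)" by (simp add: one_M7)
next
  fix x y assume "x \<in> carrier (M7 p)" "y \<in> carrier (M7 p)"
  then show "x \<otimes>\<^bsub>M7 p\<^esub> y \<in> carrier (M7 p)"
    by (elim ball_M7[rotated]) simp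
next
  fix x y z assume "x \<in> carrier (M7 p)" "y \<in> carrier (M7 p)" "z \<in> carrier (M7 p)"
  then show "x \<otimes>\<^bsub>M7 p\<^esub> y \<otimes>\<^bsub>M7 p\<^esub> z = x \<otimes>\<^bsub>M7 p\<^esub> (y \<otimes>\<^bsub>M7 p\<^esub> z)"
  proof (elim ball_M7[rotated])
    fix a b c d a' b' c' d' a'' b'' c'' d'' :: int
    have "[a + a' - d * b' + half * c' * d * (d - 1) + a'' - (d + d') * b''
          + half * c'' * (d + d') * (d + d' - 1)
        = a + (a' + a'' - d' * b'' + half * c'' * d' * (d' - 1)) - d * (b' + b'' - d' * c'')
          + half * (c' + c'') * d * (d - 1)] (mod int p)"
    \<comment> \<open>Splitting the quadratic term for d + d' produces 2 \<open>half\<close> c'' d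
      d', while the twist applied twice produces c'' d d'. They agree modulo p precisely because
      \<open>half\<close> inverts 2.\<close>
    proof (rule int_cong_if_diff_eq[where k = "c'' * d * d'"])
      have "a + a' - d * b' + half * c' * d * (d - 1) + a'' - (d + d') * b''
          + half * c'' * (d + d') * (d + d' - 1)
        - (a + (a' + a'' - d' * b'' + half * c'' * d' * (d' - 1)) - d * (b' + b'' - d' * c'')
          + half * (c' + c'') * d * (d - 1)) = (2 * half - 1) * (c'' * d * d')"
        by (simp add: algebra_simps)
      then show "a + a' - d * b' + half * c' * d * (d - 1) + a'' - (d + d') * b''
          + half * c'' * (d + d') * (d + d' - 1)
        - (a + (a' + a'' - d' * b'' + half * c'' * d' * (d' - 1)) - d * (b' + b'' - d' * c'')
          + half * (c' + c'') * d * (d - 1)) = int p * (c'' * d * d')"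
        unfolding twice_half by simp
    qed
    moreover have "[b + b' - d * c' + b'' - (d + d') * c'' = b + (b' + b'' - d' * c'') - d * (c' + c'')] (mod int p)"
      by (rule int_cong_if_diff_eq[where k = 0]) (simp add: algebra_simps)
    ultimately show "red7 p a b c d \<otimes>\<^bsub>M7 p\<^esub> red7 p a' b' c' d' \<otimes>\<^bsub>M7 p\<^esub> red7 p a'' b'' c'' d'' =
      red7 p a b c d \<otimes>\<^bsub>M7 p\<^esub> (red7 p a' b' c' d' \<otimes>\<^bsub>M7 p\<^esub> red7 p a'' b'' c'' d'')"
      unfolding mult_red7 red7_eq_iff by (simp add: add.assoc)
  qed
next
  fix x assume "x \<in> carrier (M7 p)"
  then show "\<exists>y\<in>carrier (M7 p). y \<otimes>\<^bsub>M7 p\<^esub> x = \<one>\<^bsub>M7 p\<^esub>"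
  proof (elim ball_M7[rotated])
    fix a b c d
    have "red7 p (- a - d * b - half * c * d * (d + 1)) (- b - d * c) (- c) (- d) \<otimes>\<^bsub>M7 p\<^esub> red7 p a b c d = \<one>\<^bsub>M7 p\<^esub>"
      by (simp add: one_M7 algebra_simps)
    then show "\<exists>y\<in>carrier (M7 p). y \<otimes>\<^bsub>M7 p\<^esub> red7 p a b c d = \<one>\<^bsub>M7 p\<^esub>"
      by (rule bexI) simp
  qed
next
  fix x assume "x \<in> carrier (M7 p)"
  then show "\<one>\<^bsub>M7 p\<^esub> \<otimes>\<^bsub>M7 p\<^esub> x = x"
    by (elim ball_M7[rotated]) (simp add: one_M7)
qed

lemma inv_red7 [simp]:
  "inv\<^bsub>M7 p\<^esub> red7 p a b c d = red7 p (- a - d * b - half * c * d * (d + 1)) (- b - d * c) (- c) (- d)"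
  by (rule M7.inv_equality) (simp_all add: one_M7 algebra_simps)

text \<open>Appending a factor to a k-th power moves it past z^(k d); the quadratic term of the
  multiplication then brings in the sum of squares.\<close>

lemma pow_red7:
  "red7 p a b c d [^]\<^bsub>M7 p\<^esub> n =
    red7 p (int n * a - d * b * (\<Sum>k<n. int k)
        + half * c * (d\<^sup>2 * (\<Sum>k<n. (int k)\<^sup>2) - d * (\<Sum>k<n. int k)))
      (int n * b - d * c * (\<Sum>k<n. int k)) (int n * c) (int n * d)"
  by (induction n) (simp_all add: one_M7 algebra_simps power2_eq_square)

lemma order_M7: "order (M7 p) = p ^ 4"
  by (simp add: order_def M7_def card_cartesian_product numeral_eq_Suc)

lemma generate_M7: "generate (M7 p) {red7 p 0 0 1 0, red7 p 0 0 0 1} = carrier (M7 p)"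
proof
  let ?y = "red7 p 0 0 1 0" and ?z = "red7 p 0 0 0 1"
  let ?H = "generate (M7 p) {?y, ?z}"
  have sub: "subgroup ?H (M7 p)" by (intro M7.generate_is_subgroup) auto
  then show "?H \<subseteq> carrier (M7 p)" by (rule subgroup.subset)
  have pow: "g [^]\<^bsub>M7 p\<^esub> (n::nat) \<in> ?H" if "g \<in> ?H" for g n
    using that sub by (induction n) (auto simp: subgroup.one_closed intro: subgroup.m_closed)
  have comm: "commutator (M7 p) g h \<in> ?H" if "g \<in> ?H" "h \<in> ?H" for g h
    unfolding commutator_def using that sub by (intro subgroup.m_closed subgroup.m_inv_closed)
  have y: "?y \<in> ?H" and z: "?z \<in> ?H" by (auto intro: generate.incl)
  \<comment> \<open>The relations [y,z] = x and [x,z] = w recover the two missing generators as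
    commutators.\<close>
  have x: "red7 p 0 1 0 0 \<in> ?H" using comm[OF y z] by (simp add: commutator_def)
  have w: "red7 p 1 0 0 0 \<in> ?H" using comm[OF x z] by (simp add: commutator_def)
  show "carrier (M7 p) \<subseteq> ?H"
  proof
    fix g assume g: "g \<in> carrier (M7 p)"
    then obtain a b c d where abcd: "g = (a, b, c, d)" "red7 p a b c d = g" by (rule red7_cases)
    then have "g = red7 p 1 0 0 0 [^]\<^bsub>M7 p\<^esub> nat a \<otimes>\<^bsub>M7 p\<^esub> red7 p 0 1 0 0 [^]\<^bsub>M7 p\<^esub> nat b
        \<otimes>\<^bsub>M7 p\<^esub> ?y [^]\<^bsub>M7 p\<^esub> nat c \<otimes>\<^bsub>M7 p\<^esub> ?z [^]\<^bsub>M7 p\<^esub> nat d"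
      using g by (auto simp: pow_red7) (auto simp: M7_def)
    then show "g \<in> ?H"
      using pow w x y z subgroup.m_closed[OF sub] by metis
  qed
qed

lemma red7_coords:
  "[fst (snd (snd (red7 p a b c d))) = c] (mod int p)" "[snd (snd (snd (red7 p a b c d))) = d] (mod int p)"
  by (simp_all add: red7_def)

sublocale M7: plane_coordinates "M7 p" "int p" "\<lambda>g. fst (snd (snd g))" "\<lambda>g. snd (snd (snd g))"
  "red7 p 0 0 1 0" "red7 p 0 0 0 1"
proof
  fix g h assume g: "g \<in> carrier (M7 p)" and h: "h \<in> carrier (M7 p)"
  obtain a b c d where g: "g = (a, b, c, d)" "red7 p a b c d = g" using g by (rule red7_cases)
  obtain a' b' c' d' where h: "h = (a', b', c', d')" "red7 p a' b' c' d' = h" using h by (rule red7_cases)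
  show "[fst (snd (snd (g \<otimes>\<^bsub>M7 p\<^esub> h))) = fst (snd (snd g)) + fst (snd (snd h))] (mod int p)"
    "[snd (snd (snd (g \<otimes>\<^bsub>M7 p\<^esub> h))) = snd (snd (snd g)) + snd (snd (snd h))] (mod int p)"
    unfolding g(2)[symmetric] h(2)[symmetric] mult_red7 by (simp_all add: red7_def cong_def mod_simps)
qed (simp_all add: red7_coords generate_M7, simp add: M7_def)

text \<open>All corrections are multiples of the sums of k and of k^2 below p, which p divides as
  soon as 2 and 3 are units. For p = 3 the sum of squares is 5.\<close>

lemma pow_p_M7:
  assumes "p \<ge> 5" and "g \<in> carrier (M7 p)"
  shows "g [^]\<^bsub>M7 p\<^esub> p = \<one>\<^bsub>M7 p\<^esub>"
  using assms(2)
proof (elim ball_M7[rotated])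
  fix a b c d
  have "int p dvd 2 * (\<Sum>k<p. int k)" by (simp add: twice_sum_lessThan)
  moreover have n2: "\<not> int p dvd 2" and n3: "\<not> int p dvd 3" using assms(1) by (auto dest: zdvd_imp_le)
  ultimately have T: "int p dvd (\<Sum>k<p. int k)" using prime_int by (simp add: prime_dvd_mult_iff)
  have "int p dvd 2 * (3 * (\<Sum>k<p. (int k)\<^sup>2))" using six_times_sum_squares_lessThan[of p] by simp
  with n2 n3 have S: "int p dvd (\<Sum>k<p. (int k)\<^sup>2)"
    using prime_int by (metis prime_dvd_mult_iff)
  show "red7 p a b c d [^]\<^bsub>M7 p\<^esub> p = \<one>\<^bsub>M7 p\<^esub>"
    unfolding pow_red7 one_M7 red7_eq_iff cong_0_iff
    by (intro conjI dvd_add[OF dvd_diff[OF dvd_triv_left dvd_mult[OF T]]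
          dvd_mult[OF dvd_diff[OF dvd_mult[OF S] dvd_mult[OF T]]]]
        dvd_diff[OF dvd_triv_left dvd_mult[OF T]] dvd_triv_left)
qed

lemma beauville_M7:
  assumes "p \<ge> 5"
  shows "beauville_group (M7 p)"
proof (rule M7.beauville_group_if_separated)
  show "odd (order (M7 p))" using odd_p by (simp add: order_M7)
  fix g h k l and i j :: nat
  assume g: "g \<in> carrier (M7 p)" and h: "h \<in> carrier (M7 p)"
    and kl: "k \<in> carrier (M7 p)" "l \<in> carrier (M7 p)"
    and det: "\<not> int p dvd M7.det g h"
    and eq: "conjugate (M7 p) (g [^]\<^bsub>M7 p\<^esub> i) k = conjugate (M7 p) (h [^]\<^bsub>M7 p\<^esub> j) l"
  have "int p dvd int i"
    using M7.dvd_exponents_if_conjugate_pow_eq[OF prime_int g h kl det eq] by auto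
  then obtain m where "i = p * m" by auto
  then show "g [^]\<^bsub>M7 p\<^esub> i = \<one>\<^bsub>M7 p\<^esub>"
    using g pow_p_M7[OF assms g] by (simp flip: M7.nat_pow_pow)
qed (use assms prime_int in auto)

lemma not_comm_M7: "\<not> comm_group (M7 p)"
proof
  assume "comm_group (M7 p)"
  then interpret C: comm_group "M7 p" .
  have "red7 p 0 0 1 0 \<otimes>\<^bsub>M7 p\<^esub> red7 p 0 0 0 1 = red7 p 0 0 0 1 \<otimes>\<^bsub>M7 p\<^esub> red7 p 0 0 1 0"
    by (rule C.m_comm) simp_all
  then have "int p dvd 1" by (simp add: red7_eq_iff cong_iff_dvd_diff)
  then show False using gt_2 by simp
qed

end

text \<open>Outside the abelian subgroup generated by w, x and y, a conjugacy class fills a whole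
  coset of the subgroup generated by w and x, so the exponents of y and z determine it.\<close>

lemma conjugate_M7_3:
  assumes "\<not> 3 dvd d" "[c = c'] (mod 3)" "[d = d'] (mod 3)"
  shows "\<exists>k\<in>carrier (M7 3). conjugate (M7 3) (red7 3 a b c d) k = red7 3 a' b' c' d'"
proof -
  interpret odd_prime 3 by (rule odd_prime_3)
  \<comment> \<open>The conjugator x^s y^t solves g k = k h. Comparing exponents of x gives d t = b
    - b', then those of w determine d s; both are solved by multiplying with d, its own inverse
    modulo 3.\<close>
  define t where "t = d * (b - b')"
  define s where "s = d * (a - a' + half * t * d * (d - 1))"
  let ?g = "red7 3 a b c d" and ?h = "red7 3 a' b' c' d'" and ?k = "red7 3 0 s t 0"
  have d2: "[d * d = 1] (mod 3)"
  proof -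
    have "[d = 1] (mod 3) \<or> [d = 2] (mod 3)"
      using assms(1) unfolding cong_def dvd_eq_mod_eq_0 by presburger
    then have "[d * d = 1 * 1] (mod 3) \<or> [d * d = 2 * 2] (mod 3)" by (metis cong_mult)
    moreover have "[2 * 2 = 1 :: int] (mod 3)" by (simp add: cong_def)
    ultimately show ?thesis by (auto intro: cong_trans)
  qed
  have dd: "[d * (d * u) = u] (mod 3)" for u
    using cong_mult[OF d2 cong_refl[of u]] by (simp add: mult.assoc)
  have "[a - d * s + half * t * d * (d - 1) = a - (a - a' + half * t * d * (d - 1)) + half * t * d * (d - 1)] (mod 3)"
    unfolding s_def by (intro cong_add cong_diff dd) simp_all
  then have A: "[a - d * s + half * t * d * (d - 1) = a'] (mod 3)" by simp
  have "[b + s - d * t = b + s - (b - b')] (mod 3)"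
    unfolding t_def by (intro cong_diff dd) simp_all
  then have B: "[b + s - d * t = s + b'] (mod 3)" by (simp add: algebra_simps)
  have C: "[c + t = t + c'] (mod 3)"
    using cong_add[OF assms(2) cong_refl[of t]] by (simp add: add.commute[of c' t])
  have gk: "?g \<otimes>\<^bsub>M7 3\<^esub> ?k = ?k \<otimes>\<^bsub>M7 3\<^esub> ?h"
    unfolding mult_red7 red7_eq_iff using A B C assms(3) by simp
  have "conjugate (M7 3) ?g ?k = inv\<^bsub>M7 3\<^esub> ?k \<otimes>\<^bsub>M7 3\<^esub> (?g \<otimes>\<^bsub>M7 3\<^esub> ?k)"
    unfolding conjugate_def by (rule M7.m_assoc) simp_all
  also have "\<dots> = inv\<^bsub>M7 3\<^esub> ?k \<otimes>\<^bsub>M7 3\<^esub> ?k \<otimes>\<^bsub>M7 3\<^esub> ?h"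
    unfolding gk by (rule M7.m_assoc[symmetric]) (simp_all del: inv_red7)
  also have "\<dots> = ?h" by (subst M7.l_inv) (simp_all del: inv_red7)
  finally have "conjugate (M7 3) ?g ?k = ?h" .
  then show ?thesis by (rule bexI[OF _ red7_closed])
qed

lemma not_beauville_M7_3: "\<not> beauville_group (M7 3)"
proof -
  interpret odd_prime 3 by (rule odd_prime_3)
  show ?thesis
  proof (rule M7.not_beauville_group_if_common)
    fix g h assume g: "g \<in> carrier (M7 3)" and h: "h \<in> carrier (M7 3)"
      and nd: "\<not> 3 dvd snd (snd (snd g))" "\<not> 3 dvd snd (snd (snd h))"
      and slope: "[fst (snd (snd g)) * snd (snd (snd g)) = fst (snd (snd h)) * snd (snd (snd h))] (mod 3)"
    obtain a b c d where g: "g = (a, b, c, d)" "red7 3 a b c d = g" using g by (rule red7_cases)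
    obtain a' b' c' d' where h: "h = (a', b', c', d')" "red7 3 a' b' c' d' = h" using h by (rule red7_cases)
    have nd: "\<not> 3 dvd d" "\<not> 3 dvd d'" and slope: "[c * d = c' * d'] (mod 3)"
      using nd slope by (simp_all add: g(1) h(1))
    \<comment> \<open>If the images are opposite, h^2 has the same image as g. Its exponents of w
      and x need no computation, since conjugacy holds for all choices of them.\<close>
    have "\<exists>j\<in>{1, 2::nat}. \<exists>k\<in>carrier (M7 3). conjugate (M7 3) g k = h [^]\<^bsub>M7 3\<^esub> j"
      using nd slope
    proof (rule equal_slopes_mod_3)
      assume "[c = c'] (mod 3)" "[d = d'] (mod 3)"
      from conjugate_M7_3[OF nd(1) this, of a b a' b']
      have "\<exists>k\<in>carrier (M7 3). conjugate (M7 3) g k = h [^]\<^bsub>M7 3\<^esub> (1::nat)"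
        unfolding g(2) h(2)[symmetric] by simp
      then show ?thesis by blast
    next
      assume "[c = 2 * c'] (mod 3)" "[d = 2 * d'] (mod 3)"
      from conjugate_M7_3[OF nd(1) this, of a b]
      have "\<exists>k\<in>carrier (M7 3). conjugate (M7 3) g k = h [^]\<^bsub>M7 3\<^esub> (2::nat)"
        unfolding g(2) h(2)[symmetric] pow_red7 by simp
      then show ?thesis by blast
    qed
    then obtain j k where jk: "j \<in> {1, 2::nat}" "k \<in> carrier (M7 3)"
      "conjugate (M7 3) g k = h [^]\<^bsub>M7 3\<^esub> j" by blast
    have hj: "h [^]\<^bsub>M7 3\<^esub> j \<noteq> \<one>\<^bsub>M7 3\<^esub>"
    proof -
      \<comment> \<open>The exponent of z alone already shows that the common element is
        non-trivial.\<close>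
      have "\<not> 3 dvd int j * d'" using jk(1) nd(2) by (auto simp: prime_dvd_mult_iff)
      then show ?thesis
        unfolding h(2)[symmetric] pow_red7 one_M7 red7_eq_iff by (simp add: cong_0_iff)
    qed
    have gh: "g \<in> carrier (M7 3)" "h \<in> carrier (M7 3)" using g(2) h(2) by (metis red7_closed)+
    have "conjugate (M7 3) (h [^]\<^bsub>M7 3\<^esub> j) \<one>\<^bsub>M7 3\<^esub> = h [^]\<^bsub>M7 3\<^esub> j"
      "conjugate (M7 3) (g [^]\<^bsub>M7 3\<^esub> (1::nat)) k = h [^]\<^bsub>M7 3\<^esub> j"
      using gh jk by (simp_all add: conjugate_def)
    then show "\<exists>i\<in>{1..order (M7 3)}. \<exists>j\<in>{1..order (M7 3)}. \<exists>k\<in>carrier (M7 3). \<exists>l\<in>carrier (M7 3).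
        conjugate (M7 3) (g [^]\<^bsub>M7 3\<^esub> i) k = conjugate (M7 3) (h [^]\<^bsub>M7 3\<^esub> j) l \<and>
        conjugate (M7 3) (g [^]\<^bsub>M7 3\<^esub> i) k \<noteq> \<one>\<^bsub>M7 3\<^esub>"
      using jk(1,2) hj
      by (intro bexI[of _ 1] bexI[of _ j] bexI[of _ k] bexI[of _ "\<one>\<^bsub>M7 3\<^esub>"]) (auto simp: order_M7)
  qed simp
qed


section \<open>The presented groups and their models\<close>

lemma (in group) pow_mod:
  assumes "x \<in> carrier G" "x [^] (n::nat) = \<one>"
  shows "x [^] (i mod n) = x [^] i"
proof -
  have "x [^] i = x [^] (n * (i div n) + i mod n)" by simp
  also have "\<dots> = (x [^] n) [^] (i div n) \<otimes> x [^] (i mod n)"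
    using assms(1) by (simp add: nat_pow_mult nat_pow_pow)
  finally show ?thesis using assms by simp
qed

lemma (in group) pow_mult_shift:
  assumes c: "x \<in> carrier G" "x' \<in> carrier G" "z \<in> carrier G" and "x \<otimes> z = z \<otimes> x'"
  shows "x [^] (n::nat) \<otimes> z = z \<otimes> x' [^] n"
proof (induction n)
  case (Suc n)
  have "x [^] Suc n \<otimes> z = x [^] n \<otimes> (x \<otimes> z)" using c by (simp add: m_assoc)
  also have "\<dots> = (x [^] n \<otimes> z) \<otimes> x'" using c by (simp add: assms(4) m_assoc)
  also have "\<dots> = z \<otimes> x' [^] Suc n" using c by (simp add: Suc.IH m_assoc)
  finally show ?case .
qed (use c in simp)

lemma (in group) pow_commute_pow:
  assumes c: "x \<in> carrier G" "y \<in> carrier G" and "x \<otimes> y = y \<otimes> x"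
  shows "x [^] (m::nat) \<otimes> y [^] (n::nat) = y [^] n \<otimes> x [^] m"
  using pow_mult_shift[OF c(2,2) nat_pow_closed[OF c(1)], of m n] pow_mult_shift[OF c(1,1,2) assms(3), of m]
  by simp

lemma relators2_closed: "relators2 p \<subseteq> carrier free_group"
proof -
  interpret F: group "free_group :: gen2 word set monoid" by (rule group_free_group)
  show ?thesis by (simp add: relators2_def Let_def conjugate_def)
qed

lemma relators7_closed: "relators7 p \<subseteq> carrier free_group"
proof -
  interpret F: group "free_group :: gen7 word set monoid" by (rule group_free_group)
  show ?thesis by (simp add: relators7_def Let_def commutator_def)
qed

lemma (in group) commutator_eq_iff:
  assumes "a \<in> carrier G" "b \<in> carrier G" "c \<in> carrier G"
  shows "commutator G a b \<otimes> inv c = \<one> \<longleftrightarrow> a \<otimes> b = c \<otimes> (b \<otimes> a)"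
proof -
  have "commutator G a b \<otimes> inv c = \<one> \<longleftrightarrow> commutator G a b = c"
    using assms by (metis commutator_def inv_closed inv_equality inv_inv m_closed r_inv)
  moreover have "commutator G a b = c \<longleftrightarrow> a \<otimes> b = c \<otimes> (b \<otimes> a)"
  proof -
    have "commutator G a b = (a \<otimes> b) \<otimes> inv (b \<otimes> a)"
      using assms by (simp add: commutator_def inv_mult_group m_assoc)
    then show ?thesis using assms by (metis inv_solve_right m_closed)
  qed
  ultimately show ?thesis by blast
qed

lemma (in group) commutator_eq_one_iff:
  assumes "a \<in> carrier G" "b \<in> carrier G"
  shows "commutator G a b = \<one> \<longleftrightarrow> a \<otimes> b = b \<otimes> a"
  using commutator_eq_iff[OF assms one_closed] assms by (simp add: commutator_def)

lemma (in group_hom) hom_commutator: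
  "a \<in> carrier G \<Longrightarrow> b \<in> carrier G \<Longrightarrow> h (commutator G a b) = commutator H (h a) (h b)"
  by (simp add: commutator_def)

lemma (in group) conjugate_closed: "a \<in> carrier G \<Longrightarrow> g \<in> carrier G \<Longrightarrow> conjugate G a g \<in> carrier G"
  by (simp add: conjugate_def)

lemma (in group) commutator_closed: "a \<in> carrier G \<Longrightarrow> b \<in> carrier G \<Longrightarrow> commutator G a b \<in> carrier G"
  by (simp add: commutator_def)

text \<open>The equations without inverses serve twice: applied to the quotient map they give the
  rewriting rules for normal forms, and applied to a map into the model they are what has to be
  verified.\<close>

lemma relators2_trivial_iff:
  assumes "group_hom free_group H h"
  shows "(\<forall>r\<in>relators2 p. h r = \<one>\<^bsub>H\<^esub>) \<longleftrightarrow>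
    h (free_gen X2) [^]\<^bsub>H\<^esub> (p ^ 2) = \<one>\<^bsub>H\<^esub> \<and> h (free_gen Y2) [^]\<^bsub>H\<^esub> (p ^ 2) = \<one>\<^bsub>H\<^esub> \<and>
    h (free_gen X2) \<otimes>\<^bsub>H\<^esub> h (free_gen Y2) = h (free_gen Y2) \<otimes>\<^bsub>H\<^esub> h (free_gen X2) [^]\<^bsub>H\<^esub> (p + 1)"
proof -
  interpret group_hom free_group H h by fact
  let ?x = "h (free_gen X2)" and ?y = "h (free_gen Y2)"
  have c: "?x \<in> carrier H" "?y \<in> carrier H" by simp_all
  have "conjugate H ?x ?y \<otimes>\<^bsub>H\<^esub> inv\<^bsub>H\<^esub> (?x [^]\<^bsub>H\<^esub> (p + 1)) = \<one>\<^bsub>H\<^esub>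
    \<longleftrightarrow> conjugate H ?x ?y = ?x [^]\<^bsub>H\<^esub> (p + 1)"
    using c by (metis H.conjugate_closed H.inv_closed H.inv_equality H.inv_inv H.nat_pow_closed H.r_inv)
  also have "\<dots> \<longleftrightarrow> ?x \<otimes>\<^bsub>H\<^esub> ?y = ?y \<otimes>\<^bsub>H\<^esub> ?x [^]\<^bsub>H\<^esub> (p + 1)"
    using c H.inv_solve_left[of "?x [^]\<^bsub>H\<^esub> (p + 1)" ?y "?x \<otimes>\<^bsub>H\<^esub> ?y"]
    by (auto simp: conjugate_def H.m_assoc simp del: H.nat_pow_Suc)
  finally show ?thesis
    by (simp add: relators2_def Let_def hom_nat_pow hom_conjugate G.conjugate_closed
        del: G.nat_pow_Suc H.nat_pow_Suc One_nat_def add_Suc_right)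
qed

lemma relators7_trivial_iff:
  assumes "group_hom free_group H h"
  defines "w \<equiv> h (free_gen W7)" and "x \<equiv> h (free_gen X7)" and "y \<equiv> h (free_gen Y7)" and "z \<equiv> h (free_gen Z7)"
  shows "(\<forall>r\<in>relators7 p. h r = \<one>\<^bsub>H\<^esub>) \<longleftrightarrow>
    w [^]\<^bsub>H\<^esub> p = \<one>\<^bsub>H\<^esub> \<and> x [^]\<^bsub>H\<^esub> p = \<one>\<^bsub>H\<^esub> \<and> y [^]\<^bsub>H\<^esub> p = \<one>\<^bsub>H\<^esub> \<and> z [^]\<^bsub>H\<^esub> p = \<one>\<^bsub>H\<^esub> \<and>
    y \<otimes>\<^bsub>H\<^esub> z = x \<otimes>\<^bsub>H\<^esub> (z \<otimes>\<^bsub>H\<^esub> y) \<and> x \<otimes>\<^bsub>H\<^esub> z = w \<otimes>\<^bsub>H\<^esub> (z \<otimes>\<^bsub>H\<^esub> x) \<and>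
    w \<otimes>\<^bsub>H\<^esub> x = x \<otimes>\<^bsub>H\<^esub> w \<and> w \<otimes>\<^bsub>H\<^esub> y = y \<otimes>\<^bsub>H\<^esub> w \<and> w \<otimes>\<^bsub>H\<^esub> z = z \<otimes>\<^bsub>H\<^esub> w \<and> x \<otimes>\<^bsub>H\<^esub> y = y \<otimes>\<^bsub>H\<^esub> x"
proof -
  interpret group_hom free_group H h by fact
  have "w \<in> carrier H" "x \<in> carrier H" "y \<in> carrier H" "z \<in> carrier H"
    by (simp_all add: w_def x_def y_def z_def)
  then show ?thesis
    by (simp add: relators7_def Let_def hom_nat_pow hom_commutator G.commutator_closed
        H.commutator_eq_iff H.commutator_eq_one_iff flip: w_def x_def y_def z_def)
qed

text \<open>The normal form is y^i x^j, with y in front, since the relation moves x rightwards past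
  y: x^j y = y x^((p+1) j). Exponents are first arbitrary and reduced modulo p^2 only for
  counting.\<close>

lemma order_G2_le:
  assumes "p > 0"
  shows "finite (carrier (G2 p))" "order (G2 p) \<le> p ^ 4"
proof -
  let ?P = "presented_group (relators2 p)"
  let ?x = "presented_gen (relators2 p) X2" and ?y = "presented_gen (relators2 p) Y2"
  interpret P: group ?P by (rule group_presented_group[OF relators2_closed])
  have c [simp]: "?x \<in> carrier ?P" "?y \<in> carrier ?P"
    by (simp_all add: presented_gen_closed relators2_closed)
  obtain \<pi> where "group_hom free_group ?P \<pi>" "\<And>a. \<pi> (free_gen a) = presented_gen (relators2 p) a"
    "\<And>r. r \<in> relators2 p \<Longrightarrow> \<pi> r = \<one>\<^bsub>?P\<^esub>"
    using presented_group_proj[OF relators2_closed] by metis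
  then have x: "?x [^]\<^bsub>?P\<^esub> (p ^ 2) = \<one>\<^bsub>?P\<^esub>" and y: "?y [^]\<^bsub>?P\<^esub> (p ^ 2) = \<one>\<^bsub>?P\<^esub>"
    and xy: "?x \<otimes>\<^bsub>?P\<^esub> ?y = ?y \<otimes>\<^bsub>?P\<^esub> ?x [^]\<^bsub>?P\<^esub> (p + 1)"
    using relators2_trivial_iff[of ?P \<pi> p] by simp_all
  define N where "N i j = ?y [^]\<^bsub>?P\<^esub> i \<otimes>\<^bsub>?P\<^esub> ?x [^]\<^bsub>?P\<^esub> j" for i j :: nat
  have "carrier ?P \<subseteq> {N i j |i j. True}"
  proof (rule presented_group_induct[OF relators2_closed])
    show "\<one>\<^bsub>?P\<^esub> \<in> {N i j |i j. True}" unfolding N_def by (auto intro!: exI[of _ 0])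
    show "\<exists>n>0. presented_gen (relators2 p) a [^]\<^bsub>?P\<^esub> (n::nat) = \<one>\<^bsub>?P\<^esub>" for a
      using x y assms by (cases a) (auto intro!: exI[of _ "p ^ 2"])
    fix s a assume "s \<in> {N i j |i j. True}"
    then obtain i j where s: "s = N i j" by blast
    show "s \<otimes>\<^bsub>?P\<^esub> presented_gen (relators2 p) a \<in> {N i j |i j. True}"
    proof (cases a)
      case X2
      have "s \<otimes>\<^bsub>?P\<^esub> ?x = N i (Suc j)" by (simp add: s N_def P.m_assoc)
      then show ?thesis using X2 by auto
    next
      case Y2
      have "s \<otimes>\<^bsub>?P\<^esub> ?y = ?y [^]\<^bsub>?P\<^esub> i \<otimes>\<^bsub>?P\<^esub> (?x [^]\<^bsub>?P\<^esub> j \<otimes>\<^bsub>?P\<^esub> ?y)" by (simp add: s N_def P.m_assoc)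
      also have "?x [^]\<^bsub>?P\<^esub> j \<otimes>\<^bsub>?P\<^esub> ?y = ?y \<otimes>\<^bsub>?P\<^esub> (?x [^]\<^bsub>?P\<^esub> (p + 1)) [^]\<^bsub>?P\<^esub> j"
        by (rule P.pow_mult_shift[OF _ _ _ xy]) simp_all
      also have "(?x [^]\<^bsub>?P\<^esub> (p + 1)) [^]\<^bsub>?P\<^esub> j = ?x [^]\<^bsub>?P\<^esub> ((p + 1) * j)" by (rule P.nat_pow_pow) simp
      finally have "s \<otimes>\<^bsub>?P\<^esub> ?y = N (Suc i) ((p + 1) * j)" by (simp add: N_def P.m_assoc)
      then show ?thesis using Y2 by blast
    qed
  qed
  also have "\<dots> \<subseteq> (\<lambda>(i, j). N i j) ` ({..<p ^ 2} \<times> {..<p ^ 2})"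
  proof safe
    fix i j
    have "N i j = N (i mod p ^ 2) (j mod p ^ 2)" by (simp add: N_def P.pow_mod x y)
    then show "N i j \<in> (\<lambda>(i, j). N i j) ` ({..<p ^ 2} \<times> {..<p ^ 2})"
      using assms by (intro image_eqI[of _ _ "(i mod p ^ 2, j mod p ^ 2)"]) simp_all
  qed
  finally have sub: "carrier (G2 p) \<subseteq> (\<lambda>(i, j). N i j) ` ({..<p ^ 2} \<times> {..<p ^ 2})"
    by (simp add: G2_def)
  show "finite (carrier (G2 p))" by (rule finite_subset[OF sub]) simp
  have "order (G2 p) \<le> card ({..<p ^ 2} \<times> {..<p ^ 2})"
    unfolding order_def by (rule surj_card_le[OF _ sub]) simp
  then show "order (G2 p) \<le> p ^ 4" by (simp flip: power_add)
qed

text \<open>The normal form is z^l y^i x^j w^k. Only a single z is ever moved to the front, which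
  acts on the exponents (i, j, k) by a linear map; no binomial coefficients or division by 2
  arise.\<close>

lemma order_G7_le:
  assumes "p > 0"
  shows "finite (carrier (G7 p))" "order (G7 p) \<le> p ^ 4"
proof -
  let ?P = "presented_group (relators7 p)"
  let ?g = "presented_gen (relators7 p)"
  interpret P: group ?P by (rule group_presented_group[OF relators7_closed])
  define w x y z where gens: "w = ?g W7" "x = ?g X7" "y = ?g Y7" "z = ?g Z7"
  have c [simp]: "w \<in> carrier ?P" "x \<in> carrier ?P" "y \<in> carrier ?P" "z \<in> carrier ?P"
    by (simp_all add: gens presented_gen_closed relators7_closed)
  obtain \<pi> where "group_hom free_group ?P \<pi>" "\<And>a. \<pi> (free_gen a) = ?g a"
    "\<And>r. r \<in> relators7 p \<Longrightarrow> \<pi> r = \<one>\<^bsub>?P\<^esub>"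
    using presented_group_proj[OF relators7_closed] by metis
  then have pow: "w [^]\<^bsub>?P\<^esub> p = \<one>\<^bsub>?P\<^esub>" "x [^]\<^bsub>?P\<^esub> p = \<one>\<^bsub>?P\<^esub>" "y [^]\<^bsub>?P\<^esub> p = \<one>\<^bsub>?P\<^esub>" "z [^]\<^bsub>?P\<^esub> p = \<one>\<^bsub>?P\<^esub>"
    and "y \<otimes>\<^bsub>?P\<^esub> z = x \<otimes>\<^bsub>?P\<^esub> (z \<otimes>\<^bsub>?P\<^esub> y)" "x \<otimes>\<^bsub>?P\<^esub> z = w \<otimes>\<^bsub>?P\<^esub> (z \<otimes>\<^bsub>?P\<^esub> x)"
    and wx: "w \<otimes>\<^bsub>?P\<^esub> x = x \<otimes>\<^bsub>?P\<^esub> w" and wy: "w \<otimes>\<^bsub>?P\<^esub> y = y \<otimes>\<^bsub>?P\<^esub> w" and wz: "w \<otimes>\<^bsub>?P\<^esub> z = z \<otimes>\<^bsub>?P\<^esub> w"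
    and xy: "x \<otimes>\<^bsub>?P\<^esub> y = y \<otimes>\<^bsub>?P\<^esub> x"
    using relators7_trivial_iff[of ?P \<pi> p] by (simp_all add: gens)
  have xz: "x \<otimes>\<^bsub>?P\<^esub> z = z \<otimes>\<^bsub>?P\<^esub> (x \<otimes>\<^bsub>?P\<^esub> w)"
  proof -
    have "x \<otimes>\<^bsub>?P\<^esub> z = (w \<otimes>\<^bsub>?P\<^esub> z) \<otimes>\<^bsub>?P\<^esub> x" by (simp add: \<open>x \<otimes>\<^bsub>?P\<^esub> z = _\<close> P.m_assoc)
    then show ?thesis by (simp add: wz P.m_assoc wx)
  qed
  have yz: "y \<otimes>\<^bsub>?P\<^esub> z = z \<otimes>\<^bsub>?P\<^esub> (y \<otimes>\<^bsub>?P\<^esub> (x \<otimes>\<^bsub>?P\<^esub> w))"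
  proof -
    have "y \<otimes>\<^bsub>?P\<^esub> z = (x \<otimes>\<^bsub>?P\<^esub> z) \<otimes>\<^bsub>?P\<^esub> y" by (simp add: \<open>y \<otimes>\<^bsub>?P\<^esub> z = _\<close> P.m_assoc)
    also have "\<dots> = z \<otimes>\<^bsub>?P\<^esub> (x \<otimes>\<^bsub>?P\<^esub> (w \<otimes>\<^bsub>?P\<^esub> y))" by (simp add: xz P.m_assoc)
    also have "x \<otimes>\<^bsub>?P\<^esub> (w \<otimes>\<^bsub>?P\<^esub> y) = x \<otimes>\<^bsub>?P\<^esub> y \<otimes>\<^bsub>?P\<^esub> w" by (simp add: wy P.m_assoc)
    finally show ?thesis by (simp add: xy P.m_assoc)
  qed
  \<comment> \<open>The commuting part: its elements multiply by adding exponents, so only the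
    passage of z needs real work.\<close>
  define A where "A i j k = y [^]\<^bsub>?P\<^esub> i \<otimes>\<^bsub>?P\<^esub> x [^]\<^bsub>?P\<^esub> j \<otimes>\<^bsub>?P\<^esub> w [^]\<^bsub>?P\<^esub> k" for i j k :: nat
  have A_closed [simp]: "A i j k \<in> carrier ?P" for i j k by (simp add: A_def)
  have A_mult: "A i j k \<otimes>\<^bsub>?P\<^esub> A i' j' k' = A (i + i') (j + j') (k + k')" for i j k i' j' k'
  proof -
    note comm = P.pow_commute_pow[OF _ _ wx] P.pow_commute_pow[OF _ _ wy] P.pow_commute_pow[OF _ _ xy]
    have lcomm: "a \<otimes>\<^bsub>?P\<^esub> (b \<otimes>\<^bsub>?P\<^esub> c) = b \<otimes>\<^bsub>?P\<^esub> (a \<otimes>\<^bsub>?P\<^esub> c)"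
      if "a \<otimes>\<^bsub>?P\<^esub> b = b \<otimes>\<^bsub>?P\<^esub> a" "a \<in> carrier ?P" "b \<in> carrier ?P" "c \<in> carrier ?P" for a b c
      using that by (metis P.m_assoc)
    have "A i j k \<otimes>\<^bsub>?P\<^esub> A i' j' k' = y [^]\<^bsub>?P\<^esub> i \<otimes>\<^bsub>?P\<^esub> (y [^]\<^bsub>?P\<^esub> i' \<otimes>\<^bsub>?P\<^esub>
      (x [^]\<^bsub>?P\<^esub> j \<otimes>\<^bsub>?P\<^esub> (x [^]\<^bsub>?P\<^esub> j' \<otimes>\<^bsub>?P\<^esub> (w [^]\<^bsub>?P\<^esub> k \<otimes>\<^bsub>?P\<^esub> w [^]\<^bsub>?P\<^esub> k'))))"
      by (simp add: A_def P.m_assoc lcomm[OF comm(1)] lcomm[OF comm(2)] lcomm[OF comm(3)])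
    also have "\<dots> = A (i + i') (j + j') (k + k')"
      by (simp add: A_def P.m_assoc flip: P.nat_pow_mult)
    finally show ?thesis .
  qed
  have A_pow: "A i j k [^]\<^bsub>?P\<^esub> n = A (i * n) (j * n) (k * n)" for i j k n
    by (induction n) (simp_all add: A_mult, simp_all add: A_def add.commute)
  have gen_A: "w = A 0 0 1" "x = A 0 1 0" "y = A 1 0 0" by (simp_all add: A_def)
  \<comment> \<open>Moving z to the front sends y to y x w, x to x w, and fixes w; these
    substitutions give the new exponents.\<close>
  have A_z: "A i j k \<otimes>\<^bsub>?P\<^esub> z = z \<otimes>\<^bsub>?P\<^esub> A i (i + j) (i + j + k)" for i j k
  proof -
    have w: "A 0 0 k \<otimes>\<^bsub>?P\<^esub> z = z \<otimes>\<^bsub>?P\<^esub> A 0 0 k"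
      using P.pow_mult_shift[OF _ _ _ wz, of k] by (simp add: A_def)
    have x: "A 0 j 0 \<otimes>\<^bsub>?P\<^esub> z = z \<otimes>\<^bsub>?P\<^esub> A 0 j j"
      using P.pow_mult_shift[OF _ _ _ xz, of j] unfolding gen_A A_mult A_pow by simp
    have y: "A i 0 0 \<otimes>\<^bsub>?P\<^esub> z = z \<otimes>\<^bsub>?P\<^esub> A i i i"
      using P.pow_mult_shift[OF _ _ _ yz, of i] unfolding gen_A A_mult A_pow by simp
    have "A i j k \<otimes>\<^bsub>?P\<^esub> z = A i 0 0 \<otimes>\<^bsub>?P\<^esub> (A 0 j 0 \<otimes>\<^bsub>?P\<^esub> (A 0 0 k \<otimes>\<^bsub>?P\<^esub> z))"
      by (simp add: A_mult flip: P.m_assoc)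
    also have "\<dots> = A i 0 0 \<otimes>\<^bsub>?P\<^esub> ((A 0 j 0 \<otimes>\<^bsub>?P\<^esub> z) \<otimes>\<^bsub>?P\<^esub> A 0 0 k)" by (simp add: w P.m_assoc)
    also have "\<dots> = (A i 0 0 \<otimes>\<^bsub>?P\<^esub> z) \<otimes>\<^bsub>?P\<^esub> (A 0 j j \<otimes>\<^bsub>?P\<^esub> A 0 0 k)" by (simp add: x P.m_assoc)
    also have "\<dots> = z \<otimes>\<^bsub>?P\<^esub> (A i i i \<otimes>\<^bsub>?P\<^esub> (A 0 j j \<otimes>\<^bsub>?P\<^esub> A 0 0 k))" by (simp add: y P.m_assoc)
    finally show ?thesis by (simp add: A_mult add.assoc)
  qed
  define N where "N l i j k = z [^]\<^bsub>?P\<^esub> l \<otimes>\<^bsub>?P\<^esub> A i j k" for i j k l :: nat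
  have N_A: "N l i j k \<otimes>\<^bsub>?P\<^esub> A i' j' k' = N l (i + i') (j + j') (k + k')" for i j k l i' j' k'
    by (simp add: N_def P.m_assoc A_mult)
  have N_z: "N l i j k \<otimes>\<^bsub>?P\<^esub> z = N (Suc l) i (i + j) (i + j + k)" for i j k l
    by (simp add: N_def P.m_assoc A_z)
  have "carrier ?P \<subseteq> {N l i j k |l i j k. True}"
  proof (rule presented_group_induct[OF relators7_closed])
    have "\<one>\<^bsub>?P\<^esub> = N 0 0 0 0" by (simp add: N_def A_def)
    then show "\<one>\<^bsub>?P\<^esub> \<in> {N l i j k |l i j k. True}" by blast
    show "\<exists>n>0. ?g a [^]\<^bsub>?P\<^esub> (n::nat) = \<one>\<^bsub>?P\<^esub>" for a
      using pow assms by (cases a) (auto simp: gens)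
    fix s a assume "s \<in> {N l i j k |l i j k. True}"
    then obtain l i j k where s: "s = N l i j k" by blast
    show "s \<otimes>\<^bsub>?P\<^esub> ?g a \<in> {N l i j k |l i j k. True}"
    proof (cases a)
      case W7
      then have "?g a = A 0 0 1" using gens(1) gen_A(1) by metis
      then show ?thesis unfolding s by (simp only: N_A) blast
    next
      case X7
      then have "?g a = A 0 1 0" using gens(2) gen_A(2) by metis
      then show ?thesis unfolding s by (simp only: N_A) blast
    next
      case Y7
      then have "?g a = A 1 0 0" using gens(3) gen_A(3) by metis
      then show ?thesis unfolding s by (simp only: N_A) blast
    next
      case Z7
      then have "?g a = z" by (simp add: gens)
      then show ?thesis unfolding s by (simp only: N_z) blast
    qed
  qed
  also have "\<dots> \<subseteq> (\<lambda>(l, i, j, k). N l i j k) ` ({..<p} \<times> {..<p} \<times> {..<p} \<times> {..<p})"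
  proof safe
    fix l i j k
    have "N l i j k = N (l mod p) (i mod p) (j mod p) (k mod p)" by (simp add: N_def A_def P.pow_mod pow)
    then show "N l i j k \<in> (\<lambda>(l, i, j, k). N l i j k) ` ({..<p} \<times> {..<p} \<times> {..<p} \<times> {..<p})"
      using assms by (intro image_eqI[of _ _ "(l mod p, i mod p, j mod p, k mod p)"]) simp_all
  qed
  finally have sub: "carrier (G7 p) \<subseteq> (\<lambda>(l, i, j, k). N l i j k) ` ({..<p} \<times> {..<p} \<times> {..<p} \<times> {..<p})"
    by (simp add: G7_def)
  show "finite (carrier (G7 p))" by (rule finite_subset[OF sub]) simp
  have "order (G7 p) \<le> card ({..<p} \<times> {..<p} \<times> {..<p} \<times> {..<p})"
    unfolding order_def by (rule surj_card_le[OF _ sub]) simp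
  then show "order (G7 p) \<le> p ^ 4" by (simp add: numeral_eq_Suc)
qed

context odd_prime
begin

lemma G2_iso_M2: "G2 p \<cong> M2 p"
  unfolding G2_def
proof (rule presented_group_iso[OF relators2_closed])
  let ?f = "case_gen2 (red2 p 1 0) (red2 p 0 1)"
  have UNIV: "UNIV = {X2, Y2}" using gen2.exhaust by auto
  have range: "range ?f = {red2 p 1 0, red2 p 0 1}" unfolding UNIV by simp
  show "group (M2 p)" by (rule M2.is_group)
  show "range ?f \<subseteq> carrier (M2 p)" by (simp add: range)
  show "generate (M2 p) (range ?f) = carrier (M2 p)" by (simp add: range generate_M2)
  show "finite (carrier (presented_group (relators2 p)))" "order (presented_group (relators2 p)) \<le> order (M2 p)"
    using order_G2_le[of p] gt_2 by (simp_all add: G2_def order_M2)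
  fix h r assume h: "group_hom free_group (M2 p) h" and gen: "\<And>a. h (free_gen a) = ?f a" and r: "r \<in> relators2 p"
  have "red2 p 1 0 [^]\<^bsub>M2 p\<^esub> (p ^ 2) = \<one>\<^bsub>M2 p\<^esub>" "red2 p 0 1 [^]\<^bsub>M2 p\<^esub> (p ^ 2) = \<one>\<^bsub>M2 p\<^esub>"
    by (simp_all add: pow_red2 one_M2 red2_eq_iff cong_0_iff)
  moreover have "red2 p 1 0 \<otimes>\<^bsub>M2 p\<^esub> red2 p 0 1 = red2 p 0 1 \<otimes>\<^bsub>M2 p\<^esub> red2 p 1 0 [^]\<^bsub>M2 p\<^esub> (p + 1)"
  proof -
    \<comment> \<open>This is (1 + p)(1 - p) = 1 - p^2: the twist of the model inverts the exponent
      p + 1 of the presentation.\<close>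
    have "[1 = 1 + int p - int p * (1 + int p)] (mod (int p)\<^sup>2)"
      by (rule int_cong_if_diff_eq[where k = 1]) (simp add: algebra_simps power2_eq_square)
    then show ?thesis unfolding pow_red2 mult_red2 red2_eq_iff by simp
  qed
  ultimately show "h r = \<one>\<^bsub>M2 p\<^esub>" using relators2_trivial_iff[OF h, of p] r by (simp add: gen)
qed

lemma G7_iso_M7: "G7 p \<cong> M7 p"
  unfolding G7_def
proof (rule presented_group_iso[OF relators7_closed])
  let ?f = "case_gen7 (red7 p 1 0 0 0) (red7 p 0 1 0 0) (red7 p 0 0 1 0) (red7 p 0 0 0 1)"
  have UNIV: "UNIV = {W7, X7, Y7, Z7}" using gen7.exhaust by auto
  have range: "range ?f = {red7 p 1 0 0 0, red7 p 0 1 0 0, red7 p 0 0 1 0, red7 p 0 0 0 1}"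
    unfolding UNIV by simp
  show "group (M7 p)" by (rule M7.is_group)
  show c: "range ?f \<subseteq> carrier (M7 p)" by (simp add: range)
  \<comment> \<open>The images of y and z already generate the model.\<close>
  have "carrier (M7 p) \<subseteq> generate (M7 p) (range ?f)"
    unfolding generate_M7[symmetric] range by (rule M7.mono_generate) auto
  then show "generate (M7 p) (range ?f) = carrier (M7 p)"
    using M7.generate_incl[OF c] by blast
  show "finite (carrier (presented_group (relators7 p)))" "order (presented_group (relators7 p)) \<le> order (M7 p)"
    using order_G7_le[of p] gt_2 by (simp_all add: G7_def order_M7)
  fix h r assume h: "group_hom free_group (M7 p) h" and gen: "\<And>a. h (free_gen a) = ?f a" and r: "r \<in> relators7 p"
  have "red7 p 1 0 0 0 [^]\<^bsub>M7 p\<^esub> p = \<one>\<^bsub>M7 p\<^esub>" "red7 p 0 1 0 0 [^]\<^bsub>M7 p\<^esub> p = \<one>\<^bsub>M7 p\<^esub>"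
    "red7 p 0 0 1 0 [^]\<^bsub>M7 p\<^esub> p = \<one>\<^bsub>M7 p\<^esub>" "red7 p 0 0 0 1 [^]\<^bsub>M7 p\<^esub> p = \<one>\<^bsub>M7 p\<^esub>"
    by (simp_all add: pow_red7 one_M7 red7_eq_iff cong_0_iff)
  then show "h r = \<one>\<^bsub>M7 p\<^esub>"
    using relators7_trivial_iff[OF h, of p] r by (simp add: gen)
qed

end

theorem lemma16:
  shows "(\<forall>p::nat. prime p \<and> p \<ge> 5 \<longrightarrow>
            (\<not> comm_group (G2 p) \<and> beauville_group (G2 p) \<and> order (G2 p) = p ^ 4) \<and>
            (\<not> comm_group (G7 p) \<and> beauville_group (G7 p) \<and> order (G7 p) = p ^ 4)) \<and>
         \<not> beauville_group (G2 3) \<and> \<not> beauville_group (G7 3)"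
proof (intro conjI allI impI; (elim conjE)?)
  fix p :: nat assume p: "prime p" "p \<ge> 5"
  interpret odd_prime p using p by unfold_locales auto
  note iso = G2_iso_M2 group.iso_sym[OF group_G2 G2_iso_M2] G7_iso_M7 group.iso_sym[OF group_G7 G7_iso_M7]
  show "\<not> comm_group (G2 p)"
    using comm_group.iso_imp_comm_group[OF _ iso(1) M2.is_monoid] not_comm_M2 by blast
  show "\<not> comm_group (G7 p)"
    using comm_group.iso_imp_comm_group[OF _ iso(3) M7.is_monoid] not_comm_M7 by blast
  show "beauville_group (G2 p)"
    by (rule beauville_group_iso[OF iso(2) beauville_M2[OF p(2)] group_G2])
  show "beauville_group (G7 p)"
    by (rule beauville_group_iso[OF iso(4) beauville_M7[OF p(2)] group_G7])
  show "order (G2 p) = p ^ 4" using iso_same_card[OF iso(1)] order_M2 by (simp add: order_def)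
  show "order (G7 p) = p ^ 4" using iso_same_card[OF iso(3)] order_M7 by (simp add: order_def)
next
  interpret odd_prime 3 by (rule odd_prime_3)
  show "\<not> beauville_group (G2 3)"
    using beauville_group_iso[OF G2_iso_M2 _ M2.is_group] not_beauville_M2_3 by blast
  show "\<not> beauville_group (G7 3)"
    using beauville_group_iso[OF G7_iso_M7 _ M7.is_group] not_beauville_M7_3 by blast
qed

end
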